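(* Let $z$ be the current iterate of the PSD-id and $z'$ the next iterate, computed with the preconditioner $K=(H-\sigma S)^{-1}$ for a shift $\sigma\in\big(\lambda_i,\,(\lambda_i+\lambda_{i+1})/2\big)$. If $\rho(z)\neq\sigma$ and $\rho(z)\in(\lambda_i,\lambda_{i+1})$, then $$\frac{\rho(z')-\lambda_i}{\lambda_{i+1}-\rho(z')}\le\left(\frac{\kappa}{2-\kappa}\right)^2\frac{\rho(z)-\lambda_i}{\lambda_{i+1}-\rho(z)}\quad\text{with}\quad \kappa=\left(\frac{\lambda_i-\sigma}{\lambda_{i+1}-\sigma}\right)\left(\frac{\lambda_n-\lambda_{i+1}}{\lambda_n-\lambda_i}\right).$$
   Context: Setting. $H,S\in\mathbb{C}^{n\times n}$ are Hermitian, $S$ is positive definite, and $\lambda_1\le\cdots\le\lambda_n$ are the (real) eigenvalues of the pair $(H,S)$, i.e. of $Hu=\lambda Su$. The Rayleigh quotient is $\rho(x)=(x^*Hx)/(x^*Sx)$ for $x\ne0$. Fix an index $i$. Let $u_1,\ldots,u_n$ be an $S$-orthonormal basis of $\mathbb{C}^n$ with $Hu_l=\lambda_lSu_l$, and set $U=[u_1,\ldots,u_{i-1}]$ (the already computed eigenvectors, assumed exact) and $V=[u_i,\ldots,u_n]$; $\mathrm{span}\{V\}$ is the $S$-orthogonal complement of $\mathrm{span}\{U\}$. Here $\mathrm{span}\{\cdot\}$ denotes the span of all columns of the listed matrices/vectors. Ritz pairs. For a subspace with basis matrix $W$, the Ritz values of $(H,S)$ in it are the eigenvalues of the pair $(W^*HW,W^*SW)$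 (counted with multiplicity), and the vectors $Wg$ with $g$ a corresponding eigenvector are the associated Ritz vectors. PSD-id (preconditioned steepest descent with implicit deflation). The iterates are nonzero vectors in $\mathrm{span}\{V\}$. Given an iterate $z$ and a Hermitian preconditioner $K\in\mathbb{C}^{n\times n}$, let $r=Hz-\rho(z)Sz$ and $p=Kr$. The next iterate $z'$ is an $S$-normalized Ritz vector associated with the $i$th smallest Ritz value of $(H,S)$ in $\mathrm{span}\{U,z,p\}$, where the columns of $U$ serve as Ritz vectors for the $i-1$ smallest Ritz values and $z'$ is $S$-orthogonal to them. *)

theory Defs
  imports
    Jordan_Normal_Form.Char_Poly
    Jordan_Normal_Form.Schur_Decomposition
    Jordan_Normal_Form.VS_Connect
    "HOL-Computational_Algebra.Fundamental_Theorem_Algebra"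
begin

definition hermitian_mat :: "nat \<Rightarrow> complex mat \<Rightarrow> bool" where
  "hermitian_mat n A \<longleftrightarrow> A \<in> carrier_mat n n \<and> mat_adjoint A = A"

text \<open>The form \<open>x\<^sup>* A y\<close>; note that \<open>\<bullet>c\<close> conjugates its second argument.\<close>

definition sesq :: "complex mat \<Rightarrow> complex vec \<Rightarrow> complex vec \<Rightarrow> complex" where
  "sesq A x y = (A *\<^sub>v y) \<bullet>c x"

text \<open>In the next two definitions \<open>Re\<close> loses nothing, since \<open>x\<^sup>* A x\<close> is real for Hermitian \<open>A\<close>.\<close>

definition pos_def_mat :: "nat \<Rightarrow> complex mat \<Rightarrow> bool" where
  "pos_def_mat n A \<longleftrightarrow>
     hermitian_mat n A \<and> (\<forall>x \<in> carrier_vec n. x \<noteq> 0\<^sub>v n \<longrightarrow> Re (sesq A x x) > 0)"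

definition rayleigh :: "complex mat \<Rightarrow> complex mat \<Rightarrow> complex vec \<Rightarrow> real" where
  "rayleigh H S x = Re (sesq H x x / sesq S x x)"

text \<open>The polynomial \<open>det (t B - A)\<close> in \<open>t\<close>, set up like \<^const>\<open>char_poly\<close>, which is the case
  where \<open>B\<close> is the identity. For positive definite \<open>B\<close> it is nonzero.\<close>

definition pair_char_poly :: "complex mat \<Rightarrow> complex mat \<Rightarrow> complex poly" where
  "pair_char_poly A B =
     det ([:0, 1:] \<cdot>\<^sub>m map_mat (\<lambda>b. [:b:]) B + map_mat (\<lambda>a. [:- a:]) A)"

text \<open>The eigenvalues of the pair \<open>(A, B)\<close> in ascending order, repeated according to multiplicity.
  Meant for Hermitian \<open>A\<close> and positive definite \<open>B\<close>, where all roots are real.\<close>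

definition pair_eigenvalues :: "complex mat \<Rightarrow> complex mat \<Rightarrow> real list" where
  "pair_eigenvalues A B = sorted_list_of_multiset (image_mset Re (proots (pair_char_poly A B)))"

definition pair_eigenvector :: "complex mat \<Rightarrow> complex mat \<Rightarrow> complex vec \<Rightarrow> real \<Rightarrow> bool" where
  "pair_eigenvector A B g \<theta> \<longleftrightarrow>
     g \<in> carrier_vec (dim_col A) \<and> g \<noteq> 0\<^sub>v (dim_col A) \<and>
     A *\<^sub>v g = complex_of_real \<theta> \<cdot>\<^sub>v (B *\<^sub>v g)"

abbreviation lin_span :: "nat \<Rightarrow> complex vec set \<Rightarrow> complex vec set" where
  "lin_span n X \<equiv> LinearCombinations.module.span class_ring (module_vec TYPE(complex) n) X"

definition basis_matrix :: "nat \<Rightarrow> complex mat \<Rightarrow> complex vec set \<Rightarrow> bool" where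
  "basis_matrix n W X \<longleftrightarrow>
     dim_row W = n \<and> distinct (cols W) \<and>
     \<not> module.lin_dep class_ring (module_vec TYPE(complex) n) (set (cols W)) \<and>
     lin_span n (set (cols W)) = X"

definition S_orthonormal_basis :: "nat \<Rightarrow> complex mat \<Rightarrow> (nat \<Rightarrow> complex vec) \<Rightarrow> bool" where
  "S_orthonormal_basis n S u \<longleftrightarrow>
     vectorspace.basis class_ring (module_vec TYPE(complex) n) (u ` {1..n}) \<and>
     (\<forall>l \<in> {1..n}. \<forall>m \<in> {1..n}. sesq S (u l) (u m) = (if l = m then 1 else 0))"

text \<open>\<open>x\<close> is a Ritz vector of \<open>(H, S)\<close> in the subspace \<open>X\<close> associated with the \<open>j\<close>th smallest
  Ritz value (counting from 1).\<close>

definition ritz_vector ::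
  "nat \<Rightarrow> complex mat \<Rightarrow> complex mat \<Rightarrow> complex vec set \<Rightarrow> nat \<Rightarrow> complex vec \<Rightarrow> bool" where
  "ritz_vector n H S X j x \<longleftrightarrow>
     (\<exists>W g. basis_matrix n W X \<and> 1 \<le> j \<and> j \<le> dim_col W \<and>
        (let A = mat_adjoint W * H * W; B = mat_adjoint W * S * W
         in pair_eigenvector A B g (pair_eigenvalues A B ! (j - 1))) \<and>
        x = W *\<^sub>v g)"

definition residual :: "complex mat \<Rightarrow> complex mat \<Rightarrow> complex vec \<Rightarrow> complex vec" where
  "residual H S z = H *\<^sub>v z - complex_of_real (rayleigh H S z) \<cdot>\<^sub>v (S *\<^sub>v z)"

text \<open>\<open>z'\<close> is a possible successor of \<open>z\<close> in PSD-id with preconditioner \<open>K\<close>, where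
  \<open>u 1, \<dots>, u (i - 1)\<close> are the eigenvectors already computed. It is a relation because \<open>z'\<close> is
  determined at best up to a phase factor. The last two conditions fix the choice of Ritz vectors
  when the \<open>i\<close>th smallest Ritz value coincides with a smaller one.\<close>

definition psd_id_step ::
  "nat \<Rightarrow> complex mat \<Rightarrow> complex mat \<Rightarrow> nat \<Rightarrow> (nat \<Rightarrow> complex vec) \<Rightarrow> complex mat \<Rightarrow>
   complex vec \<Rightarrow> complex vec \<Rightarrow> bool" where
  "psd_id_step n H S i u K z z' \<longleftrightarrow>
     (let p = K *\<^sub>v residual H S z;
          X = lin_span n (u ` {1..<i} \<union> {z, p})
      in ritz_vector n H S X i z' \<and> sesq S z' z' = 1 \<and>
         (\<forall>l \<in> {1..<i}. ritz_vector n H S X l (u l)) \<and>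
         (\<forall>l \<in> {1..<i}. sesq S (u l) z' = 0))"

end

theory Submission
  imports Defs "Jordan_Normal_Form.DL_Rank"
begin

text \<open>In coordinates with respect to \<open>u\<close>, the vectors of \<open>span {z, p}\<close> are those obtained from
  \<open>z\<close> by multiplying its \<open>l\<close>th coordinate by \<open>\<alpha> + \<beta> / (\<lambda>\<^sub>l - \<sigma>)\<close>; here \<open>\<rho>(z) \<noteq> \<sigma>\<close> is needed.
  Choose the affine function of \<open>1 / (\<lambda> - \<sigma>)\<close> that vanishes at the midpoint of the images of
  \<open>\<lambda>\<^sub>i\<^sub>+\<^sub>1\<close> and \<open>\<lambda>\<^sub>n\<close>. It damps every coordinate above \<open>i\<close> by the factor \<open>\<bar>\<kappa> / (2 - \<kappa>)\<bar>\<close>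
  relative to coordinate \<open>i\<close>, so the resulting vector satisfies the claimed bound, and \<open>z'\<close>
  minimises the Rayleigh quotient over \<open>span {z, p}\<close>.\<close>

subsection \<open>Sesquilinear forms\<close>

text \<open>The identity \<open>(t - \<rho>) / (t - \<sigma>) = 1 + (\<sigma> - \<rho>) / (t -
  \<sigma>)\<close> is what ties \<open>p\<close> to shift-inversion; for
  \<open>\<rho> = \<sigma>\<close> it would make \<open>p\<close> equal to \<open>z\<close>, leaving
  no freedom to filter. As \<open>\<sigma>\<close> lies in the gap,
  \<open>t \<mapsto> 1 / (t - \<sigma>)\<close> sends \<open>lam i\<close> to a negative number and
  all larger eigenvalues into a positive interval. The constant
  \<open>\<bar>\<kappa> / (2 - \<kappa>)\<bar>\<close> is exactly half the length of that interval
  divided by the distance from its midpoint to the image of \<open>lam i\<close>.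

  The obstacle is the minimality of \<open>z'\<close>. A Ritz value is only a position in a sorted
  list of polynomial roots, formed with some unknown basis matrix, and the space also contains the
  deflated eigenvectors. The whole list therefore has to be identified, with multiplicities, by a
  congruence that diagonalises the projected pair; after that the position can be exploited by
  counting.\<close>

lemma conjugate_complex: "(conjugate :: complex \<Rightarrow> complex) = cnj"
  by (rule ext) (simp add: conjugate_complex_def)

text \<open>Coordinate form from which sesquilinearity and Hermitian symmetry are computed. The
  conjugation falls on the first argument because \<open>sesq\<close> places it on the right of
  \<open>\<bullet>c\<close>.\<close>

lemma sesq_sum:
  assumes "A \<in> carrier_mat n n" "x \<in> carrier_vec n" "y \<in> carrier_vec n"
  shows "sesq A x y = (\<Sum>i<n. \<Sum>j<n. cnj (x $ i) * A $$ (i, j) * y $ j)"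
  using assms unfolding sesq_def scalar_prod_def
  by (auto simp: scalar_prod_def conjugate_complex sum_distrib_right sum_distrib_left atLeast0LessThan mult_ac intro!: sum.cong)

lemma sesq_add_right:
  assumes "A \<in> carrier_mat n n" "x \<in> carrier_vec n" "y \<in> carrier_vec n" "y' \<in> carrier_vec n"
  shows "sesq A x (y + y') = sesq A x y + sesq A x y'"
  using assms by (simp add: sesq_sum[of _ n] algebra_simps sum.distrib)

lemma sesq_smult_right:
  assumes "A \<in> carrier_mat n n" "x \<in> carrier_vec n" "y \<in> carrier_vec n"
  shows "sesq A x (c \<cdot>\<^sub>v y) = c * sesq A x y"
  using assms by (simp add: sesq_sum[of _ n] sum_distrib_left mult_ac)

lemma sesq_add_left:
  assumes "A \<in> carrier_mat n n" "x \<in> carrier_vec n" "x' \<in> carrier_vec n" "y \<in> carrier_vec n"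
  shows "sesq A (x + x') y = sesq A x y + sesq A x' y"
  using assms by (simp add: sesq_sum[of _ n] algebra_simps sum.distrib)

lemma sesq_smult_left:
  assumes "A \<in> carrier_mat n n" "x \<in> carrier_vec n" "y \<in> carrier_vec n"
  shows "sesq A (c \<cdot>\<^sub>v x) y = cnj c * sesq A x y"
  using assms by (simp add: sesq_sum[of _ n] sum_distrib_left mult_ac)

lemma sesq_zero_right:
  assumes "A \<in> carrier_mat n n" "x \<in> carrier_vec n"
  shows "sesq A x (0\<^sub>v n) = 0"
  using assms by (simp add: sesq_sum[of _ n])

lemma adjoint_carrier: "A \<in> carrier_mat n m \<Longrightarrow> mat_adjoint A \<in> carrier_mat m n"
  unfolding mat_adjoint_def by auto

lemma adjoint_index:
  assumes "A \<in> carrier_mat n m" "i < m" "j < n"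
  shows "mat_adjoint A $$ (i, j) = cnj (A $$ (j, i))"
  using assms unfolding mat_adjoint_def by (auto simp: mat_of_rows_index conjugate_complex)

lemma hermitian_carrier: "hermitian_mat n A \<Longrightarrow> A \<in> carrier_mat n n"
  by (simp add: hermitian_mat_def)

lemma hermitian_index: "hermitian_mat n A \<Longrightarrow> i < n \<Longrightarrow> j < n \<Longrightarrow> cnj (A $$ (i, j)) = A $$ (j, i)"
  unfolding hermitian_mat_def by (metis adjoint_index)

lemma sesq_hermitian:
  assumes A: "hermitian_mat n A" and x: "x \<in> carrier_vec n" "y \<in> carrier_vec n"
  shows "sesq A y x = cnj (sesq A x y)"
proof -
  have "sesq A y x = (\<Sum>i<n. \<Sum>j<n. cnj (y $ i) * A $$ (i, j) * x $ j)"
    by (rule sesq_sum) (use A x hermitian_carrier in auto)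
  also have "\<dots> = (\<Sum>j<n. \<Sum>i<n. cnj (y $ i) * A $$ (i, j) * x $ j)"
    by (rule sum.swap)
  also have "\<dots> = (\<Sum>j<n. \<Sum>i<n. cnj (cnj (x $ j) * A $$ (j, i) * y $ i))"
    by (intro sum.cong) (auto simp: hermitian_index[OF A] mult_ac)
  also have "\<dots> = cnj (sesq A x y)"
    using A x hermitian_carrier by (simp add: sesq_sum[of _ n])
  finally show ?thesis .
qed

section \<open>Adjoints and congruence\<close>

lemma adjoint_cscalar_prod:
  fixes W :: "complex mat"
  assumes "W \<in> carrier_mat n m" "x \<in> carrier_vec n" "g \<in> carrier_vec m"
  shows "(mat_adjoint W *\<^sub>v x) \<bullet>c g = x \<bullet>c (W *\<^sub>v g)"
proof -
  have "(mat_adjoint W *\<^sub>v x) \<bullet>c g = (\<Sum>i<m. \<Sum>j<n. cnj (W $$ (j, i)) * x $ j * cnj (g $ i))"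
    using assms adjoint_carrier[OF assms(1)]
    by (auto simp: scalar_prod_def conjugate_complex adjoint_index[OF assms(1)] sum_distrib_right atLeast0LessThan intro!: sum.cong)
  also have "\<dots> = (\<Sum>j<n. \<Sum>i<m. cnj (W $$ (j, i)) * x $ j * cnj (g $ i))"
    by (rule sum.swap)
  also have "\<dots> = x \<bullet>c (W *\<^sub>v g)"
    using assms
    by (auto simp: scalar_prod_def conjugate_complex sum_distrib_left atLeast0LessThan mult_ac intro!: sum.cong)
  finally show ?thesis .
qed

lemma congruence_mult_vec:
  assumes "W \<in> carrier_mat n m" "A \<in> carrier_mat n n" "g \<in> carrier_vec m"
  shows "(mat_adjoint W * A * W) *\<^sub>v g = mat_adjoint W *\<^sub>v (A *\<^sub>v (W *\<^sub>v g))"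
  using assms adjoint_carrier[OF assms(1)]
  by (simp add: assoc_mult_mat_vec[of _ m n _ n] assoc_mult_mat_vec[of _ m n _ m])

lemma sesq_congruence:
  assumes "W \<in> carrier_mat n m" "A \<in> carrier_mat n n" "h \<in> carrier_vec m" "g \<in> carrier_vec m"
  shows "sesq (mat_adjoint W * A * W) h g = sesq A (W *\<^sub>v h) (W *\<^sub>v g)"
  using assms unfolding sesq_def
  by (simp add: congruence_mult_vec[OF assms(1,2)] adjoint_cscalar_prod[OF assms(1)])

lemma sesq_unit_vec:
  assumes "A \<in> carrier_mat m m" "i < m" "j < m"
  shows "sesq A (unit_vec m i) (unit_vec m j) = A $$ (i, j)"
proof -
  have "(\<Sum>k<m. \<Sum>l<m. cnj (unit_vec m i $ k) * A $$ (k, l) * unit_vec m j $ l)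
      = (\<Sum>k<m. \<Sum>l<m. if k = i then if l = j then A $$ (k, l) else 0 else 0)"
    using assms by (intro sum.cong refl) auto
  also have "\<dots> = (\<Sum>k<m. if k = i then A $$ (k, j) else 0)"
    using assms by (intro sum.cong refl) auto
  finally show ?thesis using assms by (simp add: sesq_sum[of _ m])
qed

lemma mult_unit_vec:
  assumes "W \<in> carrier_mat n m" "j < m"
  shows "W *\<^sub>v unit_vec m j = (col W j :: complex vec)"
  using assms by (intro eq_vecI) auto

text \<open>Bridge between matrix identities and orthogonality relations: a Gram matrix is known as
  soon as the form is known on the columns.\<close>

lemma congruence_index:
  assumes "Y \<in> carrier_mat n m" "A \<in> carrier_mat n n" "i < m" "j < m"
  shows "(mat_adjoint Y * A * Y) $$ (i, j) = sesq A (col Y i) (col Y j)"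
proof -
  have "mat_adjoint Y * A * Y \<in> carrier_mat m m"
    using assms adjoint_carrier[OF assms(1)] by auto
  from sesq_unit_vec[OF this assms(3,4)] show ?thesis
    using assms by (simp add: sesq_congruence[OF assms(1,2)] mult_unit_vec)
qed

section \<open>Roots of the pair polynomial under congruence\<close>

lemma poly_pair_char_poly:
  assumes "A \<in> carrier_mat m m" "B \<in> carrier_mat m m"
  shows "poly (pair_char_poly A B) t = det (t \<cdot>\<^sub>m B - A)"
proof -
  have "map_mat (\<lambda>p. poly p t) ([:0, 1:] \<cdot>\<^sub>m map_mat (\<lambda>b. [:b:]) B + map_mat (\<lambda>a. [:- a:]) A)
      = t \<cdot>\<^sub>m B - A"
    using assms by (intro eq_matI) auto
  moreover have "comm_ring_hom (\<lambda>p :: complex poly. poly p t)"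
    by unfold_locales auto
  note comm_ring_hom.hom_det[OF this, of "[:0, 1:] \<cdot>\<^sub>m map_mat (\<lambda>b. [:b:]) B + map_mat (\<lambda>a. [:- a:]) A"]
  ultimately show ?thesis unfolding pair_char_poly_def by simp
qed

text \<open>Congruence by \<open>P\<close> multiplies \<open>det (t B - A)\<close> by a nonzero
  constant independent of \<open>t\<close>, so the roots and their multiplicities survive. After the
  congruence the pencil is diagonal and its determinant splits into linear factors.\<close>

lemma proots_pair_char_poly:
  assumes A: "A \<in> carrier_mat m m" and B: "B \<in> carrier_mat m m" and P: "P \<in> carrier_mat m m"
    and PB: "mat_adjoint P * B * P = 1\<^sub>m m"
    and PA: "mat_adjoint P * A * P = mat_diag m d"
  shows "proots (pair_char_poly A B) = image_mset d (mset_set {..<m})"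
proof -
  note P' = adjoint_carrier[OF P]
  let ?c = "det (mat_adjoint P) * det P"
  have "det (mat_adjoint P * B * P) = ?c * det B"
    using P P' B by (simp add: det_mult[of _ m])
  \<comment> \<open>Invertibility of \<open>P\<close> comes for free: the product of
    \<open>?c\<close> with \<open>det B\<close> is \<open>det 1 = 1\<close>.\<close>
  then have c: "?c \<noteq> 0" using PB by auto
  have "poly (smult ?c (pair_char_poly A B)) t = poly (\<Prod>i<m. [:- d i, 1:]) t" for t
  proof -
    have "mat_adjoint P * (t \<cdot>\<^sub>m B - A) * P = t \<cdot>\<^sub>m 1\<^sub>m m - mat_diag m d"
    proof -
      have "mat_adjoint P * (t \<cdot>\<^sub>m B - A) * P
          = (t \<cdot>\<^sub>m (mat_adjoint P * B) - mat_adjoint P * A) * P"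
        using P P' A B by (simp add: mult_minus_distrib_mat[of _ m m _ m] mult_smult_distrib[of _ m m _ m])
      also have "\<dots> = t \<cdot>\<^sub>m (mat_adjoint P * B * P) - mat_adjoint P * A * P"
        using P P' A B
        by (subst minus_mult_distrib_mat[of _ m m _ _ m]) (auto simp: mult_smult_assoc_mat[of _ m m _ m])
      finally show ?thesis unfolding PA PB .
    qed
    moreover have "det (t \<cdot>\<^sub>m 1\<^sub>m m - mat_diag m d) = (\<Prod>i<m. t - d i)"
      by (subst det_upper_triangular[of _ m])
        (auto simp: mat_diag_def prod_list_diag_prod atLeast0LessThan intro!: prod.cong upper_triangularI)
    moreover have "det (mat_adjoint P * (t \<cdot>\<^sub>m B - A) * P) = ?c * det (t \<cdot>\<^sub>m B - A)"
    proof -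
      have "t \<cdot>\<^sub>m B - A \<in> carrier_mat m m" using A B by auto
      then show ?thesis using P P' by (simp add: det_mult[of _ m])
    qed
    ultimately show ?thesis
      using A B by (simp add: poly_pair_char_poly[of _ m] poly_prod)
  qed
  then have "smult ?c (pair_char_poly A B) = (\<Prod>i<m. [:- d i, 1:])"
    using poly_eq_poly_eq_iff by blast
  then have "proots (pair_char_poly A B) = proots (\<Prod>i<m. [:- d i, 1:])"
    using proots_smult[OF c] by metis
  also have "\<dots> = (\<Sum>i<m. {#d i#})"
    by (subst proots_prod) auto
  also have "\<dots> = image_mset d (mset_set {..<m})"
    by (induction m) (auto simp: lessThan_Suc)
  finally show ?thesis .
qed

subsection \<open>Ritz values\<close>

lemma mult_zero_vec: "A \<in> carrier_mat n m \<Longrightarrow> A *\<^sub>v 0\<^sub>v m = 0\<^sub>v n"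
  for A :: "complex mat"
  by (intro eq_vecI) auto

text \<open>The vectors of \<open>carrier_vec n\<close> that satisfy \<open>P\<close> form a
  submodule containing \<open>Z\<close>, hence contain its span.\<close>

lemma lin_span_induct:
  assumes x: "x \<in> lin_span n Z" and Z: "Z \<subseteq> carrier_vec n"
    and "P (0\<^sub>v n)"
    and "\<And>x. x \<in> Z \<Longrightarrow> P x"
    and "\<And>x y. x \<in> carrier_vec n \<Longrightarrow> y \<in> carrier_vec n \<Longrightarrow> P x \<Longrightarrow> P y \<Longrightarrow> P (x + y)"
    and "\<And>c x. x \<in> carrier_vec n \<Longrightarrow> P x \<Longrightarrow> P (c \<cdot>\<^sub>v x)"
  shows "P x"
proof -
  interpret vec_space "TYPE(complex)" n .
  have "submodule class_ring {x \<in> carrier_vec n. P x} V"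
    using assms by (unfold_locales) (auto simp: module_vec_simps)
  then have "span Z \<subseteq> {x \<in> carrier_vec n. P x}"
    by (intro span_is_subset) (use assms in auto)
  then show ?thesis using x by auto
qed

lemma lin_span_carrier: "Z \<subseteq> carrier_vec n \<Longrightarrow> x \<in> lin_span n Z \<Longrightarrow> x \<in> carrier_vec n"
  by (rule lin_span_induct[of x n Z]) auto

lemma lin_span_base: "Z \<subseteq> carrier_vec n \<Longrightarrow> x \<in> Z \<Longrightarrow> x \<in> lin_span n Z"
proof -
  interpret vec_space "TYPE(complex)" n .
  show "Z \<subseteq> carrier_vec n \<Longrightarrow> x \<in> Z \<Longrightarrow> x \<in> lin_span n Z"
    by (meson in_own_span subsetD)
qed

lemma lin_span_add: "Z \<subseteq> carrier_vec n \<Longrightarrow> x \<in> lin_span n Z \<Longrightarrow> y \<in> lin_span n Z \<Longrightarrow> x + y \<in> lin_span n Z"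
proof -
  interpret vec_space "TYPE(complex)" n .
  show "Z \<subseteq> carrier_vec n \<Longrightarrow> x \<in> lin_span n Z \<Longrightarrow> y \<in> lin_span n Z \<Longrightarrow> x + y \<in> lin_span n Z"
    using span_add1 by auto
qed

lemma lin_span_smult: "Z \<subseteq> carrier_vec n \<Longrightarrow> x \<in> lin_span n Z \<Longrightarrow> c \<cdot>\<^sub>v x \<in> lin_span n Z"
proof -
  interpret vec_space "TYPE(complex)" n .
  show "Z \<subseteq> carrier_vec n \<Longrightarrow> x \<in> lin_span n Z \<Longrightarrow> c \<cdot>\<^sub>v x \<in> lin_span n Z"
    using smult_in_span by auto
qed

lemma range_smult_add:
  fixes Y :: "complex mat"
  assumes "Y \<in> carrier_mat n k" "x \<in> carrier_vec n" "y \<in> carrier_vec n"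
    and "\<exists>g \<in> carrier_vec k. x = Y *\<^sub>v g" "\<exists>g \<in> carrier_vec k. y = Y *\<^sub>v g"
  shows "\<exists>g \<in> carrier_vec k. a \<cdot>\<^sub>v x + b \<cdot>\<^sub>v y = Y *\<^sub>v g"
proof -
  obtain g h where "g \<in> carrier_vec k" "x = Y *\<^sub>v g" "h \<in> carrier_vec k" "y = Y *\<^sub>v h"
    using assms by auto
  then show ?thesis using assms(1)
    by (intro bexI[of _ "a \<cdot>\<^sub>v g + b \<cdot>\<^sub>v h"]) (auto simp: mult_add_distrib_mat_vec mult_mat_vec)
qed

lemma lin_span_range:
  fixes W :: "complex mat"
  assumes W: "W \<in> carrier_mat n m" and x: "x \<in> lin_span n Z"
    and Z: "\<And>x. x \<in> Z \<Longrightarrow> \<exists>g \<in> carrier_vec m. x = W *\<^sub>v g"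
  shows "\<exists>g \<in> carrier_vec m. x = W *\<^sub>v g"
  using x
proof (rule lin_span_induct)
  show "Z \<subseteq> carrier_vec n" using Z W by fastforce
  show "\<exists>g \<in> carrier_vec m. 0\<^sub>v n = W *\<^sub>v g"
    using W by (intro bexI[of _ "0\<^sub>v m"]) auto
  show "\<exists>g \<in> carrier_vec m. x = W *\<^sub>v g" if "x \<in> Z" for x
    using that by (rule Z)
next
  fix x y assume "\<exists>g \<in> carrier_vec m. x = W *\<^sub>v g" "\<exists>g \<in> carrier_vec m. y = W *\<^sub>v g"
  then obtain g h where "g \<in> carrier_vec m" "x = W *\<^sub>v g" "h \<in> carrier_vec m" "y = W *\<^sub>v h" by auto
  then show "\<exists>g \<in> carrier_vec m. x + y = W *\<^sub>v g"
    using W by (intro bexI[of _ "g + h"]) (auto simp: mult_add_distrib_mat_vec)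
next
  fix c x assume "\<exists>g \<in> carrier_vec m. x = W *\<^sub>v g"
  then obtain g where "g \<in> carrier_vec m" "x = W *\<^sub>v g" by auto
  then show "\<exists>g \<in> carrier_vec m. c \<cdot>\<^sub>v x = W *\<^sub>v g"
    using W by (intro bexI[of _ "c \<cdot>\<^sub>v g"]) (auto simp: mult_mat_vec)
qed

lemma lin_span_cols:
  assumes W: "W \<in> carrier_mat n m" and x: "x \<in> lin_span n (set (cols W))"
  shows "\<exists>g \<in> carrier_vec m. x = W *\<^sub>v g"
proof (rule lin_span_range[OF W x])
  show "\<exists>g \<in> carrier_vec m. x = W *\<^sub>v g" if "x \<in> set (cols W)" for x
    using that W by (auto simp: cols_def mult_unit_vec[symmetric] intro: bexI[of _ "unit_vec m _"])
qed

section \<open>Change of basis matrix\<close>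

lemma factor_through:
  fixes W Y :: "complex mat"
  assumes W: "W \<in> carrier_mat n m" and Y: "Y \<in> carrier_mat n k"
    and "\<And>j. j < k \<Longrightarrow> \<exists>g \<in> carrier_vec m. col Y j = W *\<^sub>v g"
  shows "\<exists>P \<in> carrier_mat m k. Y = W * P"
proof -
  obtain g where g: "\<And>j. j < k \<Longrightarrow> g j \<in> carrier_vec m \<and> col Y j = W *\<^sub>v g j"
    using assms(3) by metis
  let ?P = "mat_of_cols m (map g [0..<k])"
  have "Y = W * ?P"
  proof (rule mat_col_eqI)
    fix j assume "j < dim_col (W * ?P)"
    then have j: "j < k" by simp
    then have "col (W * ?P) j = W *\<^sub>v col ?P j"
      using W by (subst col_mult2[of _ n m _ k]) auto
    also have "\<dots> = col Y j" using g[OF j] j by simp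
    finally show "col Y j = col (W * ?P) j" ..
  qed (use W Y in auto)
  then show ?thesis by (intro bexI[of _ ?P]) auto
qed

lemma mat_mult_left_cancel:
  fixes W :: "complex mat"
  assumes W: "W \<in> carrier_mat n m" and M: "M \<in> carrier_mat m k" and N: "N \<in> carrier_mat m k"
    and inj: "\<And>g. g \<in> carrier_vec m \<Longrightarrow> W *\<^sub>v g = 0\<^sub>v n \<Longrightarrow> g = 0\<^sub>v m"
    and eq: "W * M = W * N"
  shows "M = N"
proof (rule mat_col_eqI)
  fix j assume "j < dim_col N"
  then have j: "j < k" using N by simp
  let ?x = "col M j" and ?y = "col N j"
  have x: "?x \<in> carrier_vec m" and y: "?y \<in> carrier_vec m" using M N j by auto
  have "W *\<^sub>v ?x = W *\<^sub>v ?y"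
    using eq W M N j by (metis col_mult2)
  then have "W *\<^sub>v (?x - ?y) = 0\<^sub>v n"
    using W x y by (simp add: mult_minus_distrib_mat_vec)
  then have d: "?x - ?y = 0\<^sub>v m" by (rule inj[rotated]) (use x y in auto)
  show "?x = ?y"
  proof (rule eq_vecI)
    fix i assume "i < dim_vec ?y"
    then have "(?x - ?y) $ i = 0" using d y N by simp
    then show "?x $ i = ?y $ i" using x y \<open>i < dim_vec ?y\<close> by simp
  qed (use M N in auto)
qed (use M N in auto)

text \<open>Trace argument: \<open>P * Q\<close> and \<open>Q * P\<close> have equal traces, and the
  trace of an identity matrix is its size. This makes the change of basis square, as determinants
  require.\<close>

lemma two_sided_inverse_square:
  fixes P Q :: "complex mat"
  assumes P: "P \<in> carrier_mat m k" and Q: "Q \<in> carrier_mat k m"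
    and PQ: "P * Q = 1\<^sub>m m" and QP: "Q * P = 1\<^sub>m k"
  shows "m = k"
proof -
  have "of_nat m = (\<Sum>i<m. (P * Q) $$ (i, i))" unfolding PQ by simp
  also have "\<dots> = (\<Sum>i<m. \<Sum>j<k. P $$ (i, j) * Q $$ (j, i))"
    using P Q by (intro sum.cong) (auto simp: scalar_prod_def atLeast0LessThan)
  also have "\<dots> = (\<Sum>j<k. \<Sum>i<m. P $$ (i, j) * Q $$ (j, i))" by (rule sum.swap)
  also have "\<dots> = (\<Sum>j<k. (Q * P) $$ (j, j))"
    using P Q by (intro sum.cong) (auto simp: scalar_prod_def atLeast0LessThan mult.commute)
  also have "\<dots> = of_nat k" unfolding QP by simp
  finally show ?thesis by (simp only: of_nat_eq_iff)
qed

text \<open>Ritz values do not depend on the basis matrix, so they can be read off an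
  \<open>S\<close>-orthonormal system \<open>Y\<close> that diagonalises \<open>H\<close>. Both
  \<open>W\<close> and \<open>Y\<close> are injective (\<open>Y\<close> has the left inverse
  \<open>mat_adjoint Y * S\<close>) and have range \<open>X\<close>. Hence \<open>Y = W * P\<close>
  and \<open>W = Y * Q\<close> with mutually inverse \<open>P\<close> and \<open>Q\<close>, and
  congruence by \<open>P\<close> carries the pair projected by \<open>W\<close> to the diagonal pair
  projected by \<open>Y\<close>.\<close>

lemma pair_eigenvalues_compression:
  fixes H S W Y :: "complex mat" and d :: "nat \<Rightarrow> real"
  assumes H: "H \<in> carrier_mat n n" and S: "S \<in> carrier_mat n n"
    and W: "basis_matrix n W X"
    and Y: "Y \<in> carrier_mat n k"
    and YX: "\<And>j. j < k \<Longrightarrow> col Y j \<in> X"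
    and XY: "\<And>x. x \<in> X \<Longrightarrow> \<exists>g \<in> carrier_vec k. x = Y *\<^sub>v g"
    and YS: "\<And>i j. i < k \<Longrightarrow> j < k \<Longrightarrow> sesq S (col Y i) (col Y j) = (if i = j then 1 else 0)"
    and YH: "\<And>i j. i < k \<Longrightarrow> j < k \<Longrightarrow> sesq H (col Y i) (col Y j) = (if i = j then of_real (d j) else 0)"
  shows "pair_eigenvalues (mat_adjoint W * H * W) (mat_adjoint W * S * W)
    = sort (map d [0..<k])"
proof -
  interpret vec_space "TYPE(complex)" n .
  define m where "m = dim_col W"
  have Wc: "W \<in> carrier_mat n m" and X: "lin_span n (set (cols W)) = X"
    using W unfolding basis_matrix_def m_def by auto
  have Winj: "g = 0\<^sub>v m" if "g \<in> carrier_vec m" "W *\<^sub>v g = 0\<^sub>v n" for g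
  proof (rule ccontr)
    assume "g \<noteq> 0\<^sub>v m"
    from lin_depI[OF Wc that(1) this that(2)] show False
      using W unfolding basis_matrix_def by simp
  qed
  have YSY: "mat_adjoint Y * S * Y = 1\<^sub>m k"
    by (rule eq_matI) (use Y S YS adjoint_carrier[OF Y] congruence_index[OF Y S] in auto)
  have YHY: "mat_adjoint Y * H * Y = mat_diag k (\<lambda>i. of_real (d i))"
    by (rule eq_matI) (use Y H YH adjoint_carrier[OF Y] congruence_index[OF Y H] in \<open>auto simp: mat_diag_def\<close>)
  have Yinj: "g = 0\<^sub>v k" if "g \<in> carrier_vec k" "Y *\<^sub>v g = 0\<^sub>v n" for g
  proof -
    have "g = (mat_adjoint Y * S * Y) *\<^sub>v g" unfolding YSY using that by simp
    also have "\<dots> = mat_adjoint Y *\<^sub>v (S *\<^sub>v (Y *\<^sub>v g))"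
      using congruence_mult_vec[OF Y S that(1)] .
    also have "\<dots> = 0\<^sub>v k" using that S adjoint_carrier[OF Y] by (simp add: mult_zero_vec[of _ n n] mult_zero_vec[of _ k n])
    finally show ?thesis .
  qed
  have "\<exists>P \<in> carrier_mat m k. Y = W * P"
    by (rule factor_through[OF Wc Y]) (rule lin_span_cols[OF Wc], simp add: X YX)
  then obtain P where P: "P \<in> carrier_mat m k" "Y = W * P" ..
  have WX: "col W j \<in> X" if "j < m" for j
    unfolding X[symmetric]
  proof (rule lin_span_base)
    show "set (cols W) \<subseteq> carrier_vec n" using Wc cols_dim by blast
    show "col W j \<in> set (cols W)" using Wc that by (simp add: cols_def)
  qed
  have "\<exists>Q \<in> carrier_mat k m. W = Y * Q"
    by (rule factor_through[OF Y Wc]) (rule XY, simp add: WX)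
  then obtain Q where Q: "Q \<in> carrier_mat k m" "W = Y * Q" ..
  have PQ: "P * Q = 1\<^sub>m m"
  proof (rule mat_mult_left_cancel[OF Wc _ _ Winj])
    show "W * (P * Q) = W * 1\<^sub>m m"
      unfolding assoc_mult_mat[OF Wc P(1) Q(1), symmetric] P(2)[symmetric] Q(2)[symmetric]
      using Wc by simp
  qed (use P(1) Q(1) in auto)
  have QP: "Q * P = 1\<^sub>m k"
  proof (rule mat_mult_left_cancel[OF Y _ _ Yinj])
    show "Y * (Q * P) = Y * 1\<^sub>m k"
      unfolding assoc_mult_mat[OF Y Q(1) P(1), symmetric] P(2)[symmetric] Q(2)[symmetric]
      using Y by simp
  qed (use P(1) Q(1) in auto)
  have mk: "m = k" by (rule two_sided_inverse_square[OF P(1) Q(1) PQ QP])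
  have Pk: "P \<in> carrier_mat k k" and Wk: "W \<in> carrier_mat n k" using P Wc mk by auto
  have cong: "mat_adjoint P * (mat_adjoint W * A * W) * P = mat_adjoint Y * A * Y"
    if A: "A \<in> carrier_mat n n" for A
  proof (rule eq_matI)
    fix i j assume "i < dim_row (mat_adjoint Y * A * Y)" "j < dim_col (mat_adjoint Y * A * Y)"
    then have ij: "i < k" "j < k" using Y adjoint_carrier[OF Y] by auto
    have M: "mat_adjoint W * A * W \<in> carrier_mat k k"
      using Wk A adjoint_carrier[OF Wk] by auto
    have "(mat_adjoint P * (mat_adjoint W * A * W) * P) $$ (i, j)
      = sesq A (W *\<^sub>v col P i) (W *\<^sub>v col P j)"
      using ij Pk by (simp add: congruence_index[OF Pk M] sesq_congruence[OF Wk A])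
    also have "\<dots> = sesq A (col Y i) (col Y j)"
      unfolding P(2) using ij Wk Pk by (simp only: col_mult2[of _ n k _ k])
    also have "\<dots> = (mat_adjoint Y * A * Y) $$ (i, j)"
      using congruence_index[OF Y A ij] ..
    finally show "(mat_adjoint P * (mat_adjoint W * A * W) * P) $$ (i, j) = (mat_adjoint Y * A * Y) $$ (i, j)" .
  qed (use Y Pk adjoint_carrier[OF Pk] adjoint_carrier[OF Y] in auto)
  have "proots (pair_char_poly (mat_adjoint W * H * W) (mat_adjoint W * S * W))
    = image_mset (\<lambda>i. of_real (d i)) (mset_set {..<k})"
    by (rule proots_pair_char_poly[OF _ _ Pk])
      (use Wk H S adjoint_carrier[OF Wk] cong YSY YHY in auto)
  then have "image_mset Re (proots (pair_char_poly (mat_adjoint W * H * W) (mat_adjoint W * S * W)))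
    = mset (map d [0..<k])"
    by (simp add: image_mset.compositionality o_def atLeast0LessThan)
  then show ?thesis unfolding pair_eigenvalues_def by (simp only: sorted_list_of_multiset_mset)
qed

subsection \<open>Scalar estimates\<close>

text \<open>Centre the means at the two ends of the gap. Around \<open>l i\<close> the term
  \<open>k = i\<close> vanishes and every other term is damped, so the numerator falls by
  \<open>\<epsilon>\<^sup>2 * (f i)\<^sup>2\<close>. Around \<open>l (Suc i)\<close> only the term
  \<open>k = i\<close> is negative, and the others are nonnegative and scaled by at most
  \<open>(f i)\<^sup>2\<close>, so the denominator is at least \<open>(f i)\<^sup>2\<close> times
  the old one. The first two conclusions ensure that the filtered vector is nonzero and that its
  quotient stays inside the range where the bound is monotone.\<close>

lemma weighted_mean_contraction:
  fixes a f l :: "nat \<Rightarrow> real"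
  assumes i: "i < n"
    and l: "\<And>k. k \<in> {Suc i..n} \<Longrightarrow> l (Suc i) \<le> l k" "l i < l (Suc i)"
    and a: "\<And>k. k \<in> {i..n} \<Longrightarrow> 0 \<le> a k" "0 < (\<Sum>k=i..n. a k)"
    and f: "f i \<noteq> 0" "\<And>k. k \<in> {Suc i..n} \<Longrightarrow> \<bar>f k\<bar> \<le> \<epsilon> * \<bar>f i\<bar>"
    and \<epsilon>: "0 \<le> \<epsilon>" "\<epsilon> \<le> 1"
    and Q: "Q = (\<Sum>k=i..n. l k * a k) / (\<Sum>k=i..n. a k)" "Q < l (Suc i)"
    and R: "R = (\<Sum>k=i..n. l k * (a k * (f k)\<^sup>2)) / (\<Sum>k=i..n. a k * (f k)\<^sup>2)"
  shows "0 < (\<Sum>k=i..n. a k * (f k)\<^sup>2)" "R < l (Suc i)"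
    "(R - l i) / (l (Suc i) - R) \<le> \<epsilon>\<^sup>2 * ((Q - l i) / (l (Suc i) - Q))"
proof -
  let ?w = "\<lambda>k. a k * (f k)\<^sup>2"
  define s t where "s = (\<Sum>k=i..n. a k)" and "t = (\<Sum>k=i..n. ?w k)"
  have s: "s > 0" using a s_def by simp
  have centre: "(\<Sum>k=i..n. (l k - c) * g k) = (\<Sum>k=i..n. l k * g k) - c * (\<Sum>k=i..n. g k)" for c g
    by (simp add: algebra_simps sum_subtractf sum_distrib_left)
  have f2: "(f k)\<^sup>2 \<le> \<epsilon>\<^sup>2 * (f i)\<^sup>2" if "k \<in> {Suc i..n}" for k
    using power_mono[OF f(2)[OF that], of 2] by (simp add: power_mult_distrib)
  have e1: "\<epsilon>\<^sup>2 \<le> 1" using \<epsilon> by (simp add: power_le_one)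
  \<comment> \<open>The denominator only needs that no coordinate grows relative to coordinate
    \<open>i\<close>; this is where \<open>\<epsilon> \<le> 1\<close> enters.\<close>
  have f3: "(f k)\<^sup>2 \<le> (f i)\<^sup>2" if "k \<in> {Suc i..n}" for k
    using f2[OF that] mult_right_mono[OF e1, of "(f i)\<^sup>2"] by simp
  have lk: "l i \<le> l k" if "k \<in> {i..n}" for k
  proof (cases "k = i")
    case False
    then have "k \<in> {Suc i..n}" using that by auto
    then show ?thesis using l by fastforce
  qed simp
  have cmp: "(l k - l i) * ?w k \<le> (\<epsilon>\<^sup>2 * (f i)\<^sup>2) * ((l k - l i) * a k)
      \<and> (l k - l (Suc i)) * ?w k \<le> (f i)\<^sup>2 * ((l k - l (Suc i)) * a k)" if k: "k \<in> {i..n}" for k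
  proof (cases "k = i")
    case False
    then have k': "k \<in> {Suc i..n}" using k by auto
    have "((l k - l i) * a k) * (f k)\<^sup>2 \<le> ((l k - l i) * a k) * (\<epsilon>\<^sup>2 * (f i)\<^sup>2)"
      by (rule mult_left_mono[OF f2[OF k']]) (use lk a k in auto)
    moreover have "((l k - l (Suc i)) * a k) * (f k)\<^sup>2 \<le> ((l k - l (Suc i)) * a k) * (f i)\<^sup>2"
      by (rule mult_left_mono[OF f3[OF k']]) (use l k' a k in auto)
    ultimately show ?thesis by (simp add: mult_ac)
  qed (auto simp: mult_ac)
  have N: "(\<Sum>k=i..n. (l k - l i) * ?w k) \<le> (\<epsilon>\<^sup>2 * (f i)\<^sup>2) * (\<Sum>k=i..n. (l k - l i) * a k)"
    unfolding sum_distrib_left by (rule sum_mono) (use cmp in blast)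
  have D: "(\<Sum>k=i..n. (l k - l (Suc i)) * ?w k) \<le> (f i)\<^sup>2 * (\<Sum>k=i..n. (l k - l (Suc i)) * a k)"
    unfolding sum_distrib_left by (rule sum_mono) (use cmp in blast)
  have Qs: "(\<Sum>k=i..n. l k * a k) = Q * s" using Q s s_def by simp
  have Da: "(\<Sum>k=i..n. (l k - l (Suc i)) * a k) = - ((l (Suc i) - Q) * s)"
    unfolding centre Qs s_def by (simp add: algebra_simps)
  have Na: "(\<Sum>k=i..n. (l k - l i) * a k) = (Q - l i) * s"
    unfolding centre Qs s_def by (simp add: algebra_simps)
  have fi: "(f i)\<^sup>2 > 0" using f by simp
  have Dpos: "(\<Sum>k=i..n. (l k - l (Suc i)) * ?w k) < 0"
    by (rule le_less_trans[OF D]) (use fi s Q in \<open>simp add: Da mult_pos_pos\<close>)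
  \<comment> \<open>If the filtered weights had sum zero, each of them would vanish, and so would
    the sum that \<open>Dpos\<close> shows to be negative.\<close>
  have tpos: "t > 0"
  proof (rule ccontr)
    assume "\<not> t > 0"
    moreover have "t \<ge> 0" unfolding t_def by (intro sum_nonneg mult_nonneg_nonneg) (use a in auto)
    ultimately have "t = 0" by simp
    then have "\<forall>k\<in>{i..n}. ?w k = 0"
      unfolding t_def by (subst (asm) sum_nonneg_eq_0_iff) (use a in auto)
    then have "(\<Sum>k=i..n. (l k - l (Suc i)) * ?w k) = 0" by (intro sum.neutral) auto
    then show False using Dpos by simp
  qed
  then show "0 < (\<Sum>k=i..n. a k * (f k)\<^sup>2)" by (simp add: t_def)
  have Rt: "(\<Sum>k=i..n. l k * ?w k) = R * t" using R tpos t_def by simp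
  have Dw: "(\<Sum>k=i..n. (l k - l (Suc i)) * ?w k) = - ((l (Suc i) - R) * t)"
    unfolding centre Rt t_def by (simp add: algebra_simps)
  have Nw: "(\<Sum>k=i..n. (l k - l i) * ?w k) = (R - l i) * t"
    unfolding centre Rt t_def by (simp add: algebra_simps)
  have "(l (Suc i) - R) * t > 0" using Dpos unfolding Dw by simp
  then have "l (Suc i) - R > 0" using tpos by (simp only: zero_less_mult_pos2)
  then show R1: "R < l (Suc i)" by simp
  have N0: "0 \<le> (\<Sum>k=i..n. (l k - l i) * a k)"
    by (intro sum_nonneg mult_nonneg_nonneg) (use a lk in auto)
  have "(R - l i) / (l (Suc i) - R) = ((R - l i) * t) / ((l (Suc i) - R) * t)"
    using tpos by simp
  also have "\<dots> \<le> ((\<epsilon>\<^sup>2 * (f i)\<^sup>2) * ((Q - l i) * s)) / ((f i)\<^sup>2 * ((l (Suc i) - Q) * s))"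
  proof (rule frac_le)
    show "0 \<le> (\<epsilon>\<^sup>2 * (f i)\<^sup>2) * ((Q - l i) * s)" using N0 unfolding Na by simp
    show "(R - l i) * t \<le> (\<epsilon>\<^sup>2 * (f i)\<^sup>2) * ((Q - l i) * s)" using N Nw Na by simp
    show "0 < (f i)\<^sup>2 * ((l (Suc i) - Q) * s)" using fi s Q by simp
    show "(f i)\<^sup>2 * ((l (Suc i) - Q) * s) \<le> (l (Suc i) - R) * t" using D Dw Da by simp
  qed
  also have "\<dots> = \<epsilon>\<^sup>2 * ((Q - l i) / (l (Suc i) - Q))"
    using fi s by (simp add: divide_simps)
  finally show "(R - l i) / (l (Suc i) - R) \<le> \<epsilon>\<^sup>2 * ((Q - l i) / (l (Suc i) - Q))" .
qed

text \<open>The filter \<open>t \<mapsto> m - 1 / (t - \<sigma>)\<close> is the Chebyshev polynomial of degree one in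
  the shift-inverted variable: \<open>m\<close> is the midpoint of the image of \<open>[l1, ln]\<close>.\<close>

lemma shift_invert_filter:
  fixes l0 l1 ln \<sigma> :: real
  assumes \<sigma>: "l0 < \<sigma>" "\<sigma> < l1" and l: "l1 \<le> ln"
    and m: "m = (1 / (l1 - \<sigma>) + 1 / (ln - \<sigma>)) / 2"
    and \<kappa>: "\<kappa> = ((l0 - \<sigma>) / (l1 - \<sigma>)) * ((ln - l1) / (ln - l0))"
  shows "m - 1 / (l0 - \<sigma>) \<noteq> 0" "\<bar>\<kappa> / (2 - \<kappa>)\<bar> \<le> 1"
    "\<And>t. l1 \<le> t \<Longrightarrow> t \<le> ln \<Longrightarrow> \<bar>m - 1 / (t - \<sigma>)\<bar> \<le> \<bar>\<kappa> / (2 - \<kappa>)\<bar> * \<bar>m - 1 / (l0 - \<sigma>)\<bar>"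
proof -
  \<comment> \<open>Distances of the shift from \<open>l0\<close>, \<open>l1\<close> and
    \<open>ln\<close>. In these terms \<open>\<kappa>\<close> is visibly nonpositive, and the image
    of \<open>[l1, ln]\<close> is \<open>[1 / w, 1 / y]\<close>.\<close>
  define x y w where "x = \<sigma> - l0" and "y = l1 - \<sigma>" and "w = ln - \<sigma>"
  have pos: "x > 0" "y > 0" "w > 0" "y \<le> w" using assms by (auto simp: x_def y_def w_def)
  have k: "\<kappa> = - (x * (w - y) / (y * (w + x)))"
  proof -
    have e: "l0 - \<sigma> = - x" "l1 - \<sigma> = y" "ln - l1 = w - y" "ln - l0 = w + x"
      by (auto simp: x_def y_def w_def)
    show ?thesis unfolding \<kappa> e by simp
  qed
  have m': "m = (1 / y + 1 / w) / 2" unfolding m by (simp add: y_def w_def)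
  have g: "m - 1 / (l0 - \<sigma>) = (1 / y + 1 / w) / 2 + 1 / x"
    unfolding m' x_def by (simp add: divide_simps) (simp add: algebra_simps)
  have gpos: "(1 / y + 1 / w) / 2 + 1 / x > 0" using pos by (intro add_pos_pos half_gt_zero) auto
  then show "m - 1 / (l0 - \<sigma>) \<noteq> 0" unfolding g by simp
  have k0: "\<kappa> \<le> 0" unfolding k using pos by (intro neg_le_0_iff_le[THEN iffD2] divide_nonneg_pos) auto
  then show "\<bar>\<kappa> / (2 - \<kappa>)\<bar> \<le> 1" by (simp add: abs_le_iff divide_simps)
  \<comment> \<open>With \<open>\<kappa> = - q\<close> the factor is \<open>q / (2 + q)\<close>. Its
    denominator, once fractions are cleared, is the numerator of the distance from \<open>m\<close>
    to \<open>- 1 / x\<close>, so the product collapses to half the length of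
    \<open>[1 / w, 1 / y]\<close>.\<close>
  have eps: "\<bar>\<kappa> / (2 - \<kappa>)\<bar> * \<bar>m - 1 / (l0 - \<sigma>)\<bar> = (1 / y - 1 / w) / 2"
  proof -
    define q where "q = x * (w - y) / (y * (w + x))"
    have q0: "q \<ge> 0" unfolding q_def using pos by (intro divide_nonneg_pos) auto
    have "\<bar>\<kappa> / (2 - \<kappa>)\<bar> = q / (2 + q)" unfolding k q_def[symmetric] using q0 by simp
    also have "\<dots> = x * (w - y) / (2 * (y * (w + x)) + x * (w - y))"
    proof -
      have "u / v / (2 + u / v) = u / (2 * v + u)" if "v > 0" for u v :: real
        using that by (simp add: divide_simps)
      from this[of "y * (w + x)" "x * (w - y)"] show ?thesis unfolding q_def using pos by simp
    qed
    finally have 1: "\<bar>\<kappa> / (2 - \<kappa>)\<bar> = x * (w - y) / (2 * (y * (w + x)) + x * (w - y))" .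
    have 2: "(1 / y + 1 / w) / 2 + 1 / x = (2 * (y * (w + x)) + x * (w - y)) / (2 * x * y * w)"
      using pos by (simp add: divide_simps) (simp add: algebra_simps)
    have "2 * (y * (w + x)) + x * (w - y) > 0" using pos by (intro add_pos_nonneg) auto
    then show ?thesis unfolding g abs_of_pos[OF gpos] 1 2 using pos by (simp add: divide_simps)
  qed
  fix t assume t: "l1 \<le> t" "t \<le> ln"
  then have ty: "y \<le> t - \<sigma>" "t - \<sigma> \<le> w" by (auto simp: y_def w_def)
  have "1 / (t - \<sigma>) \<le> 1 / y" "1 / w \<le> 1 / (t - \<sigma>)"
    using ty pos by (auto intro!: divide_left_mono)
  moreover have "\<bar>(p + q) / 2 - r\<bar> \<le> (p - q) / 2" if "r \<le> p" "q \<le> r" for p q r :: real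
    using that by (simp add: abs_le_iff field_simps)
  ultimately show "\<bar>m - 1 / (t - \<sigma>)\<bar> \<le> \<bar>\<kappa> / (2 - \<kappa>)\<bar> * \<bar>m - 1 / (l0 - \<sigma>)\<bar>"
    unfolding eps unfolding m' by blast
qed

text \<open>In the sorted list, an entry strictly below the one at position \<open>j\<close> must
  stand before \<open>j\<close>; sorting does not change how many such entries there are.\<close>

lemma length_filter_less_sort_nth:
  fixes xs :: "'a :: linorder list"
  assumes j: "j < length xs"
  shows "length (filter (\<lambda>x. x < sort xs ! j) xs) \<le> j"
proof -
  let ?P = "\<lambda>x. x < sort xs ! j"
  have "k < j" if "k < length xs" "?P (sort xs ! k)" for k
    using that sorted_nth_mono[OF sorted_sort, of j k xs] by (cases "k < j") auto
  then have "{k. k < length (sort xs) \<and> ?P (sort xs ! k)} \<subseteq> {..<j}" by auto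
  then have "card {k. k < length (sort xs) \<and> ?P (sort xs ! k)} \<le> card {..<j}"
    by (rule card_mono[rotated]) simp
  then have "length (filter ?P (sort xs)) \<le> j" by (simp only: length_filter_conv_card card_lessThan)
  moreover have "length (filter ?P (sort xs)) = length (filter ?P xs)"
    by (metis filter_sort length_sort)
  ultimately show ?thesis by simp
qed

subsection \<open>Coordinates in an eigenbasis\<close>

lemma smult_mat_mult_vec:
  fixes A :: "complex mat"
  assumes "A \<in> carrier_mat n m" "x \<in> carrier_vec m"
  shows "(c \<cdot>\<^sub>m A) *\<^sub>v x = c \<cdot>\<^sub>v (A *\<^sub>v x)"
  using assms by (intro eq_vecI) (auto simp: scalar_prod_def sum_distrib_left mult.assoc)

lemma rayleigh_smult:
  assumes "H \<in> carrier_mat n n" "S \<in> carrier_mat n n" "x \<in> carrier_vec n" "c \<noteq> 0"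
  shows "rayleigh H S (c \<cdot>\<^sub>v x) = rayleigh H S x"
  using assms unfolding rayleigh_def by (simp add: sesq_smult_left[of _ n] sesq_smult_right[of _ n])

lemma sesq_hermitian_real:
  assumes "hermitian_mat n A" "x \<in> carrier_vec n"
  shows "sesq A x x = of_real (Re (sesq A x x))"
  using sesq_hermitian[OF assms assms(2)] by (metis Reals_cnj_iff of_real_Re)

text \<open>The coordinates of \<open>x\<close> in this frame are the numbers
  \<open>sesq S (u l) x\<close>; in them \<open>S\<close> becomes the identity and \<open>H\<close>
  the diagonal matrix of the \<open>lam l\<close>.\<close>

locale eigenframe =
  fixes n :: nat and H S :: "complex mat" and lam :: "nat \<Rightarrow> real" and u :: "nat \<Rightarrow> complex vec"
  assumes H: "hermitian_mat n H"
    and S: "pos_def_mat n S"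
    and u: "S_orthonormal_basis n S u"
    and Hu: "\<And>l. l \<in> {1..n} \<Longrightarrow> H *\<^sub>v u l = complex_of_real (lam l) \<cdot>\<^sub>v (S *\<^sub>v u l)"
begin

lemma H_carrier: "H \<in> carrier_mat n n" using H by (rule hermitian_carrier)

lemma S_hermitian: "hermitian_mat n S" using S by (simp add: pos_def_mat_def)

lemma S_carrier: "S \<in> carrier_mat n n" using S_hermitian by (rule hermitian_carrier)

lemma u_carrier: "l \<in> {1..n} \<Longrightarrow> u l \<in> carrier_vec n"
proof -
  interpret vec_space "TYPE(complex)" n .
  show "l \<in> {1..n} \<Longrightarrow> u l \<in> carrier_vec n"
    using u unfolding S_orthonormal_basis_def basis_def by auto
qed

lemma u_orthonormal: "l \<in> {1..n} \<Longrightarrow> m \<in> {1..n} \<Longrightarrow> sesq S (u l) (u m) = (if l = m then 1 else 0)"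
  using u unfolding S_orthonormal_basis_def by blast

text \<open>Columns count from 0 and eigenvectors from 1, hence the shift by \<open>Suc\<close> here
  and below.\<close>

definition frame :: "complex mat" where "frame = mat_of_cols n (map (\<lambda>j. u (Suc j)) [0..<n])"

lemma frame_carrier: "frame \<in> carrier_mat n n" by (rule carrier_matI) (simp_all add: frame_def)

lemma col_frame: "j < n \<Longrightarrow> col frame j = u (Suc j)"
  unfolding frame_def using u_carrier[of "Suc j"] by (subst col_mat_of_cols) (auto simp del: upt_Suc)

lemma frame_expand:
  assumes x: "x \<in> carrier_vec n"
  shows "x = frame *\<^sub>v vec n (\<lambda>j. sesq S (u (Suc j)) x)"
proof -
  let ?U = "frame"
  note U = frame_carrier and U' = adjoint_carrier[OF frame_carrier]
  have "mat_adjoint ?U * S * ?U = 1\<^sub>m n"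
  proof (rule eq_matI)
    fix i j assume "i < dim_row (1\<^sub>m n :: complex mat)" "j < dim_col (1\<^sub>m n :: complex mat)"
    then show "(mat_adjoint ?U * S * ?U) $$ (i, j) = 1\<^sub>m n $$ (i, j)"
      by (subst congruence_index[OF U S_carrier]) (auto simp: col_frame u_orthonormal)
  qed (use U U' in auto)
  \<comment> \<open>\<open>mat_adjoint frame * S\<close> is a left inverse of a square matrix, hence
    also a right inverse; the latter is the expansion formula.\<close>
  then have inv: "?U * (mat_adjoint ?U * S) = 1\<^sub>m n"
    using mat_mult_left_right_inverse[of "mat_adjoint ?U * S" n ?U] U U' S_carrier by auto
  have "x = (?U * (mat_adjoint ?U * S)) *\<^sub>v x" unfolding inv using x by simp
  also have "\<dots> = ?U *\<^sub>v (mat_adjoint ?U *\<^sub>v (S *\<^sub>v x))"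
    using U U' S_carrier x by (simp add: assoc_mult_mat_vec[of _ n n _ n])
  also have "mat_adjoint ?U *\<^sub>v (S *\<^sub>v x) = vec n (\<lambda>j. sesq S (u (Suc j)) x)"
  proof (rule eq_vecI)
    fix j assume "j < dim_vec (vec n (\<lambda>j. sesq S (u (Suc j)) x))"
    then have j: "j < n" by simp
    have "(mat_adjoint ?U *\<^sub>v (S *\<^sub>v x)) $ j = (mat_adjoint ?U *\<^sub>v (S *\<^sub>v x)) \<bullet>c unit_vec n j"
      using U' S_carrier x j by (simp add: scalar_prod_def conjugate_complex if_distrib[of cnj] if_distrib[of "(*) _"] sum.delta cong: if_cong)
    also have "\<dots> = (S *\<^sub>v x) \<bullet>c (?U *\<^sub>v unit_vec n j)"
      by (rule adjoint_cscalar_prod[OF U]) (use S_carrier x in auto)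
    also have "\<dots> = sesq S (u (Suc j)) x"
      using mult_unit_vec[OF U j] col_frame[OF j] by (simp add: sesq_def)
    finally show "(mat_adjoint ?U *\<^sub>v (S *\<^sub>v x)) $ j = vec n (\<lambda>j. sesq S (u (Suc j)) x) $ j"
      using j by simp
  qed (use U' in auto)
  finally show ?thesis .
qed

lemma coordinates_eqI:
  assumes "x \<in> carrier_vec n" "y \<in> carrier_vec n"
    and "\<And>l. l \<in> {1..n} \<Longrightarrow> sesq S (u l) x = sesq S (u l) y"
  shows "x = y"
proof -
  have "vec n (\<lambda>j. sesq S (u (Suc j)) x) = vec n (\<lambda>j. sesq S (u (Suc j)) y)"
    using assms(3) by (intro eq_vecI) auto
  then show ?thesis using frame_expand[OF assms(1)] frame_expand[OF assms(2)] by simp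
qed

lemma sesq_expand:
  assumes A: "A \<in> carrier_mat n n" and x: "x \<in> carrier_vec n" and y: "y \<in> carrier_vec n"
  shows "sesq A x y = (\<Sum>l=1..n. cnj (sesq S (u l) x) * sesq A (u l) y)"
proof -
  let ?c = "vec n (\<lambda>j. sesq S (u (Suc j)) x)"
  have "sesq A x y = (A *\<^sub>v y) \<bullet>c (frame *\<^sub>v ?c)"
    unfolding sesq_def by (subst frame_expand[OF x]) (simp add: sesq_def)
  also have "\<dots> = (\<Sum>k<n. (A *\<^sub>v y) $ k * cnj (\<Sum>j<n. frame $$ (k, j) * ?c $ j))"
    using A y frame_carrier by (auto simp: scalar_prod_def conjugate_complex atLeast0LessThan intro!: sum.cong)
  also have "\<dots> = (\<Sum>k<n. \<Sum>j<n. cnj (?c $ j) * ((A *\<^sub>v y) $ k * cnj (col frame j $ k)))"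
    using frame_carrier by (auto simp: sum_distrib_left mult_ac intro!: sum.cong)
  also have "\<dots> = (\<Sum>j<n. \<Sum>k<n. cnj (?c $ j) * ((A *\<^sub>v y) $ k * cnj (col frame j $ k)))"
    by (rule sum.swap)
  also have "\<dots> = (\<Sum>j<n. cnj (sesq S (u (Suc j)) x) * sesq A (u (Suc j)) y)"
  proof (rule sum.cong[OF refl])
    fix j assume "j \<in> {..<n}"
    then have "col frame j = u (Suc j)" "u (Suc j) \<in> carrier_vec n"
      using col_frame u_carrier by auto
    then have "sesq A (u (Suc j)) y = (\<Sum>k<n. (A *\<^sub>v y) $ k * cnj (col frame j $ k))"
      unfolding sesq_def scalar_prod_def conjugate_complex[symmetric]
      by (auto simp: atLeast0LessThan intro!: sum.cong)
    then show "(\<Sum>k<n. cnj (?c $ j) * ((A *\<^sub>v y) $ k * cnj (col frame j $ k)))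
        = cnj (sesq S (u (Suc j)) x) * sesq A (u (Suc j)) y"
      using \<open>j \<in> {..<n}\<close> by (simp add: sum_distrib_left)
  qed
  also have "\<dots> = (\<Sum>l=1..n. cnj (sesq S (u l) x) * sesq A (u l) y)"
    using sum.atLeast1_atMost_eq[of "\<lambda>l. cnj (sesq S (u l) x) * sesq A (u l) y" n] by simp
  finally show ?thesis .
qed

section \<open>The forms, the residual and the preconditioner in eigenbasis coordinates\<close>

lemma sesq_H_u_right:
  assumes "l \<in> {1..n}" "x \<in> carrier_vec n"
  shows "sesq H x (u l) = lam l * sesq S x (u l)"
  using assms u_carrier S_carrier Hu unfolding sesq_def by auto

lemma sesq_H_u_left:
  assumes l: "l \<in> {1..n}" and x: "x \<in> carrier_vec n"
  shows "sesq H (u l) x = lam l * sesq S (u l) x"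
  using sesq_hermitian[OF H x u_carrier[OF l]] sesq_hermitian[OF S_hermitian x u_carrier[OF l]]
    sesq_H_u_right[OF l x] by simp

lemma sesq_S_self:
  assumes "x \<in> carrier_vec n"
  shows "sesq S x x = of_real (\<Sum>l=1..n. (cmod (sesq S (u l) x))\<^sup>2)"
  using sesq_expand[OF S_carrier assms assms] by (simp add: complex_norm_square[symmetric] mult.commute)

lemma sesq_H_self:
  assumes "x \<in> carrier_vec n"
  shows "sesq H x x = of_real (\<Sum>l=1..n. lam l * (cmod (sesq S (u l) x))\<^sup>2)"
proof -
  have "sesq H x x = (\<Sum>l=1..n. cnj (sesq S (u l) x) * (lam l * sesq S (u l) x))"
    unfolding sesq_expand[OF H_carrier assms assms]
    by (intro sum.cong refl) (simp add: sesq_H_u_left assms)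
  also have "\<dots> = of_real (\<Sum>l=1..n. lam l * (cmod (sesq S (u l) x))\<^sup>2)"
    unfolding of_real_sum
    by (intro sum.cong refl) (simp only: of_real_mult complex_norm_square mult_ac)
  finally show ?thesis .
qed

lemma rayleigh_eq:
  assumes "x \<in> carrier_vec n"
  shows "rayleigh H S x = (\<Sum>l=1..n. lam l * (cmod (sesq S (u l) x))\<^sup>2) / (\<Sum>l=1..n. (cmod (sesq S (u l) x))\<^sup>2)"
  unfolding rayleigh_def sesq_S_self[OF assms] sesq_H_self[OF assms] by (simp flip: of_real_divide)

lemma S_pos: "x \<in> carrier_vec n \<Longrightarrow> x \<noteq> 0\<^sub>v n \<Longrightarrow> Re (sesq S x x) > 0"
  using S by (simp add: pos_def_mat_def)

lemma sesq_residual: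
  assumes l: "l \<in> {1..n}" and z: "z \<in> carrier_vec n"
  shows "(residual H S z) \<bullet>c u l = (lam l - rayleigh H S z) * sesq S (u l) z"
proof -
  have "(residual H S z) \<bullet>c u l = sesq H (u l) z - rayleigh H S z * sesq S (u l) z"
    using u_carrier[OF l] z H_carrier S_carrier unfolding residual_def sesq_def
    by (subst minus_scalar_prod_distrib[of _ n]) auto
  then show ?thesis by (simp add: sesq_H_u_left[OF l z] algebra_simps)
qed

text \<open>Pair \<open>(H - \<sigma> S) p = r\<close> with \<open>u l\<close>: the eigenvector
  relation turns the left side into a multiple of the coordinate of \<open>p\<close>. The product
  form postpones the division until \<open>lam l \<noteq> \<sigma>\<close> is available.\<close>

lemma preconditioned_coordinates:
  assumes l: "l \<in> {1..n}" and z: "z \<in> carrier_vec n"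
    and K: "K \<in> carrier_mat n n" "inverts_mat (H - complex_of_real \<sigma> \<cdot>\<^sub>m S) K"
  shows "(lam l - \<sigma>) * sesq S (u l) (K *\<^sub>v residual H S z) = (lam l - rayleigh H S z) * sesq S (u l) z"
proof -
  let ?p = "K *\<^sub>v residual H S z"
  let ?M = "H - complex_of_real \<sigma> \<cdot>\<^sub>m S"
  have r: "residual H S z \<in> carrier_vec n" using z H_carrier S_carrier by (auto simp: residual_def)
  then have p: "?p \<in> carrier_vec n" using K by auto
  have M: "?M \<in> carrier_mat n n" using H_carrier S_carrier by auto
  have "?M *\<^sub>v ?p = (?M * K) *\<^sub>v residual H S z" using M K r by simp
  also have "?M * K = 1\<^sub>m n" using K(2) M H_carrier S_carrier unfolding inverts_mat_def by simp
  finally have eq: "?M *\<^sub>v ?p = residual H S z" using r by simp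
  have "?M *\<^sub>v ?p = H *\<^sub>v ?p - of_real \<sigma> \<cdot>\<^sub>v (S *\<^sub>v ?p)"
    using H_carrier S_carrier p
    by (simp add: minus_mult_distrib_mat_vec[of _ n n] smult_mat_mult_vec[of _ n n])
  moreover have "(H *\<^sub>v ?p - of_real \<sigma> \<cdot>\<^sub>v (S *\<^sub>v ?p)) \<bullet>c u l = sesq H (u l) ?p - \<sigma> * sesq S (u l) ?p"
    using u_carrier[OF l] p H_carrier S_carrier unfolding sesq_def
    by (subst minus_scalar_prod_distrib[of _ n]) auto
  ultimately have "(residual H S z) \<bullet>c u l = sesq H (u l) ?p - \<sigma> * sesq S (u l) ?p"
    unfolding eq by metis
  then show ?thesis
    using sesq_residual[OF l z] sesq_H_u_left[OF l p] by (simp add: algebra_simps)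
qed

subsection \<open>Ritz vectors of the deflated space\<close>

text \<open>Being \<open>S\<close>-orthogonal to the deflated eigenvectors removes their
  contribution, so \<open>z'\<close> will turn out to lie in the span of \<open>z\<close> and
  \<open>p\<close> alone.\<close>

lemma deflated_span_coordinates:
  assumes i: "i \<in> {1..n}"
    and z: "z \<in> carrier_vec n" "\<And>l. l \<in> {1..<i} \<Longrightarrow> sesq S (u l) z = 0"
    and p: "p \<in> carrier_vec n" "\<And>l. l \<in> {1..<i} \<Longrightarrow> sesq S (u l) p = 0"
    and x: "x \<in> lin_span n (u ` {1..<i} \<union> {z, p})" "\<And>l. l \<in> {1..<i} \<Longrightarrow> sesq S (u l) x = 0"
  shows "\<exists>a b. x = a \<cdot>\<^sub>v z + b \<cdot>\<^sub>v p"
proof -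
  have G: "u ` {1..<i} \<union> {z, p} \<subseteq> carrier_vec n" using u_carrier i z p by auto
  have uc: "u l \<in> carrier_vec n" if "l \<in> {i..n}" for l using that i u_carrier by auto
  \<comment> \<open>Only coordinates from \<open>i\<close> on are tracked: there the generators
    \<open>u l\<close> with \<open>l < i\<close> have coordinate zero, so \<open>a\<close> and
    \<open>b\<close> come from \<open>z\<close> and \<open>p\<close>. Below \<open>i\<close> all
    vectors in question have coordinate zero.\<close>
  let ?P = "\<lambda>x. \<exists>a b. \<forall>l\<in>{i..n}. sesq S (u l) x = a * sesq S (u l) z + b * sesq S (u l) p"
  have "?P x"
    using x(1) G
  proof (rule lin_span_induct)
    show "?P (0\<^sub>v n)"
      by (rule exI[of _ 0], rule exI[of _ 0]) (simp add: sesq_zero_right[OF S_carrier] uc)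
  next
    fix x assume "x \<in> u ` {1..<i} \<union> {z, p}"
    then consider l where "l \<in> {1..<i}" "x = u l" | "x = z" | "x = p" by auto
    then show "?P x"
    proof cases
      case 1
      then show ?thesis using i u_orthonormal
        by (intro exI[of _ 0]) auto
    next
      case 2
      then show ?thesis by (intro exI[of _ 1] exI[of _ 0]) auto
    next
      case 3
      then show ?thesis by (intro exI[of _ 0] exI[of _ 1]) auto
    qed
  next
    fix x y assume xy: "x \<in> carrier_vec n" "y \<in> carrier_vec n" "?P x" "?P y"
    then obtain a b c d where
      "\<forall>l\<in>{i..n}. sesq S (u l) x = a * sesq S (u l) z + b * sesq S (u l) p"
      "\<forall>l\<in>{i..n}. sesq S (u l) y = c * sesq S (u l) z + d * sesq S (u l) p" by blast
    then show "?P (x + y)"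
      by (intro exI[of _ "a + c"] exI[of _ "b + d"])
        (simp add: sesq_add_right[OF S_carrier] uc xy algebra_simps)
  next
    fix c x assume xy: "x \<in> carrier_vec n" "?P x"
    then obtain a b where
      "\<forall>l\<in>{i..n}. sesq S (u l) x = a * sesq S (u l) z + b * sesq S (u l) p" by blast
    then show "?P (c \<cdot>\<^sub>v x)"
      by (intro exI[of _ "c * a"] exI[of _ "c * b"])
        (simp add: sesq_smult_right[OF S_carrier] uc xy algebra_simps)
  qed
  then obtain a b where ab: "\<And>l. l\<in>{i..n} \<Longrightarrow> sesq S (u l) x = a * sesq S (u l) z + b * sesq S (u l) p"
    by blast
  have "x = a \<cdot>\<^sub>v z + b \<cdot>\<^sub>v p"
  proof (rule coordinates_eqI)
    show "x \<in> carrier_vec n" by (rule lin_span_carrier[OF G x(1)])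
    show "a \<cdot>\<^sub>v z + b \<cdot>\<^sub>v p \<in> carrier_vec n" using z p by simp
    fix l assume l: "l \<in> {1..n}"
    have "sesq S (u l) (a \<cdot>\<^sub>v z + b \<cdot>\<^sub>v p) = a * sesq S (u l) z + b * sesq S (u l) p"
      using z p u_carrier[OF l] by (simp add: sesq_add_right[OF S_carrier] sesq_smult_right[OF S_carrier])
    then show "sesq S (u l) x = sesq S (u l) (a \<cdot>\<^sub>v z + b \<cdot>\<^sub>v p)"
      using ab[of l] x(2)[of l] z(2)[of l] p(2)[of l] l by (cases "l < i") auto
  qed
  then show ?thesis by blast
qed

text \<open>Pairing the projected eigenvalue equation with \<open>h\<close> says that
  \<open>H x - \<theta> S x\<close> is orthogonal to \<open>W h\<close>, hence to the whole
  subspace. The matrix \<open>W\<close> is passed on as well, since the position of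
  \<open>\<theta>\<close> in the list of Ritz values is needed later.\<close>

lemma ritz_vector_galerkin:
  assumes G: "G \<subseteq> carrier_vec n" and ritz: "ritz_vector n H S (lin_span n G) j x"
  obtains W \<theta> where "basis_matrix n W (lin_span n G)" "1 \<le> j"
    "\<theta> = pair_eigenvalues (mat_adjoint W * H * W) (mat_adjoint W * S * W) ! (j - 1)"
    "x \<in> lin_span n G"
    "\<And>y. y \<in> lin_span n G \<Longrightarrow> sesq H y x = of_real \<theta> * sesq S y x"
proof -
  obtain W g where W: "basis_matrix n W (lin_span n G)" "1 \<le> j" "j \<le> dim_col W"
    and g: "pair_eigenvector (mat_adjoint W * H * W) (mat_adjoint W * S * W) g
      (pair_eigenvalues (mat_adjoint W * H * W) (mat_adjoint W * S * W) ! (j - 1))"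
    and x: "x = W *\<^sub>v g"
    using ritz unfolding ritz_vector_def Let_def by blast
  define A B \<theta> where "A = mat_adjoint W * H * W" and "B = mat_adjoint W * S * W"
    and "\<theta> = pair_eigenvalues A B ! (j - 1)"
  define m where "m = dim_col W"
  have Wc: "W \<in> carrier_mat n m" and X: "lin_span n (set (cols W)) = lin_span n G"
    using W unfolding basis_matrix_def m_def by auto
  note W' = adjoint_carrier[OF Wc]
  have AB: "A \<in> carrier_mat m m" "B \<in> carrier_mat m m"
    unfolding A_def B_def using Wc W' H_carrier S_carrier by auto
  have gc: "g \<in> carrier_vec m" and gA: "A *\<^sub>v g = of_real \<theta> \<cdot>\<^sub>v (B *\<^sub>v g)"
    using g AB unfolding pair_eigenvector_def A_def[symmetric] B_def[symmetric] \<theta>_def[symmetric] by auto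
  have cc: "set (cols W) \<subseteq> carrier_vec n" using Wc cols_dim by blast
  have "x \<in> lin_span n (set (cols W))"
  proof -
    interpret vec_space "TYPE(complex)" n .
    have "vec m (($) g) = g" using gc by auto
    moreover have "mat_of_cols n (cols W) = W" using Wc by (metis carrier_matD(1) mat_of_cols_cols)
    moreover have "\<forall>w\<in>set (cols W). dim_vec w = n" using cc by auto
    ultimately have "W *\<^sub>v g = lincomb_list (($) g) (cols W)"
      using lincomb_list_as_mat_mult[of "cols W" "($) g"] Wc by (simp add: cols_length)
    then have "W *\<^sub>v g \<in> span_list (cols W)" unfolding span_list_def by blast
    then have "W *\<^sub>v g \<in> span (set (cols W))" unfolding span_list_as_span[OF cc] .
    then show ?thesis using x by simp
  qed
  moreover have "sesq H y x = of_real \<theta> * sesq S y x" if "y \<in> lin_span n G" for y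
  proof -
    have "\<exists>h \<in> carrier_vec m. y = W *\<^sub>v h"
      by (rule lin_span_cols[OF Wc]) (simp only: X that)
    then obtain h where h: "h \<in> carrier_vec m" "y = W *\<^sub>v h" ..
    have "sesq H y x = sesq A h g"
      unfolding A_def h(2) x by (rule sesq_congruence[OF Wc H_carrier h(1) gc, symmetric])
    also have "\<dots> = of_real \<theta> * sesq B h g"
      unfolding sesq_def gA using AB h gc by simp
    also have "sesq B h g = sesq S y x"
      unfolding B_def h(2) x by (rule sesq_congruence[OF Wc S_carrier h(1) gc])
    finally show ?thesis .
  qed
  ultimately show ?thesis
    unfolding X by (rule that[OF W(1,2) \<theta>_def[unfolded A_def B_def]])
qed

text \<open>The \<open>i\<close>th Ritz value of the deflated space is the smaller Ritz value of \<open>span {z, p}\<close>: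
  completing \<open>u 1, \<dots>, u (i - 1), z'\<close> by one more vector \<open>w\<close> diagonalises the projected pair, and
  if \<open>w\<close> had the smaller Rayleigh quotient, then \<open>i\<close> Ritz values would lie below the \<open>i\<close>th.\<close>

lemma deflated_ritz_vector_minimal:
  assumes i: "i \<in> {1..n}"
    and lam: "\<And>l m. l \<in> {1..n} \<Longrightarrow> m \<in> {1..n} \<Longrightarrow> l \<le> m \<Longrightarrow> lam l \<le> lam m"
    and z: "z \<in> carrier_vec n" "\<And>l. l \<in> {1..<i} \<Longrightarrow> sesq S (u l) z = 0"
    and p: "p \<in> carrier_vec n" "\<And>l. l \<in> {1..<i} \<Longrightarrow> sesq S (u l) p = 0"
    and ritz: "ritz_vector n H S (lin_span n (u ` {1..<i} \<union> {z, p})) i z'"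
    and z': "sesq S z' z' = 1" "\<And>l. l \<in> {1..<i} \<Longrightarrow> sesq S (u l) z' = 0"
    and x: "x = c \<cdot>\<^sub>v z + d \<cdot>\<^sub>v p" "x \<noteq> 0\<^sub>v n"
  shows "rayleigh H S z' \<le> rayleigh H S x"
proof -
  define X where "X = lin_span n (u ` {1..<i} \<union> {z, p})"
  have G: "u ` {1..<i} \<union> {z, p} \<subseteq> carrier_vec n" using u_carrier i z p by auto
  obtain W \<theta> where W: "basis_matrix n W X"
    and \<theta>: "\<theta> = pair_eigenvalues (mat_adjoint W * H * W) (mat_adjoint W * S * W) ! (i - 1)"
    and z'X: "z' \<in> X"
    and gal: "\<And>y. y \<in> X \<Longrightarrow> sesq H y z' = of_real \<theta> * sesq S y z'"
    using ritz_vector_galerkin[OF G ritz] unfolding X_def by metis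
  note SS = sesq_add_right[OF S_carrier] sesq_smult_right[OF S_carrier]
    sesq_add_left[OF S_carrier] sesq_smult_left[OF S_carrier]
  note HH = sesq_add_right[OF H_carrier] sesq_smult_right[OF H_carrier]
    sesq_add_left[OF H_carrier] sesq_smult_left[OF H_carrier]
  have z'c: "z' \<in> carrier_vec n" using lin_span_carrier[OF G] z'X X_def by simp
  have zX: "z \<in> X" and pX: "p \<in> X" unfolding X_def by (rule lin_span_base[OF G], simp)+
  have uX: "u l \<in> X" if "l \<in> {1..<i}" for l unfolding X_def using that by (intro lin_span_base[OF G]) auto
  have combX: "a \<cdot>\<^sub>v x + b \<cdot>\<^sub>v y \<in> X" if "x \<in> X" "y \<in> X" for a b x y
    using that unfolding X_def by (intro lin_span_add[OF G] lin_span_smult[OF G])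
  have \<theta>eq: "rayleigh H S z' = \<theta>"
    unfolding rayleigh_def using gal[OF z'X] z' by simp
  obtain a b where ab: "z' = a \<cdot>\<^sub>v z + b \<cdot>\<^sub>v p"
    using deflated_span_coordinates[OF i z p _ z'(2)] z'X X_def by metis
  \<comment> \<open>The coefficients are chosen so that \<open>y\<close> is
    \<open>S\<close>-orthogonal to \<open>z'\<close> within the span of \<open>z\<close> and
    \<open>p\<close>.\<close>
  define s t where "s = sesq S z' p" and "t = - sesq S z' z"
  define y where "y = s \<cdot>\<^sub>v z + t \<cdot>\<^sub>v p"
  have yc: "y \<in> carrier_vec n" using z p by (simp add: y_def)
  have yX: "y \<in> X" unfolding y_def by (rule combX[OF zX pX])
  have z'y: "sesq S z' y = 0"
    unfolding y_def using z p z'c by (simp add: SS s_def t_def)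
  have "sesq S z' z' = a * sesq S z' z + b * sesq S z' p"
    by (subst (2) ab) (use z p z'c in \<open>simp add: SS\<close>)
  \<comment> \<open>The normalisation of \<open>z'\<close> says that the change from
    \<open>z, p\<close> to \<open>y, z'\<close> has determinant 1. The inverse formulas
    \<open>z_eq\<close> and \<open>p_eq\<close> thus need no division and also hold when
    \<open>z\<close> and \<open>p\<close> are dependent.\<close>
  then have det: "b * s - a * t = 1" using z'(1) by (simp add: s_def t_def add.commute)
  have z_eq: "z = b \<cdot>\<^sub>v y + (- t) \<cdot>\<^sub>v z'"
  proof (rule eq_vecI)
    fix j assume "j < dim_vec (b \<cdot>\<^sub>v y + (- t) \<cdot>\<^sub>v z')"
    then have j: "j < n" using z'c by simp
    have "b * (s * z $ j + t * p $ j) + - t * (a * z $ j + b * p $ j) = (b * s - a * t) * z $ j"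
      by (simp add: algebra_simps)
    then show "z $ j = (b \<cdot>\<^sub>v y + (- t) \<cdot>\<^sub>v z') $ j"
      unfolding y_def ab using j z p det by simp
  qed (use z z'c in auto)
  have p_eq: "p = (- a) \<cdot>\<^sub>v y + s \<cdot>\<^sub>v z'"
  proof (rule eq_vecI)
    fix j assume "j < dim_vec ((- a) \<cdot>\<^sub>v y + s \<cdot>\<^sub>v z')"
    then have j: "j < n" using z'c by simp
    have "- a * (s * z $ j + t * p $ j) + s * (a * z $ j + b * p $ j) = (b * s - a * t) * p $ j"
      by (simp add: algebra_simps)
    then show "p $ j = ((- a) \<cdot>\<^sub>v y + s \<cdot>\<^sub>v z') $ j"
      unfolding y_def ab using j z p det by simp
  qed (use p z'c in auto)
  define e f where "e = c * b - d * a" and "f = d * s - c * t"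
  have x_eq: "x = e \<cdot>\<^sub>v y + f \<cdot>\<^sub>v z'"
    unfolding x(1) by (subst z_eq, subst p_eq, rule eq_vecI)
      (use yc z'c in \<open>auto simp: e_def f_def algebra_simps\<close>)
  show ?thesis
  \<comment> \<open>If \<open>y\<close> vanishes, \<open>z\<close> and \<open>p\<close> are both
    multiples of \<open>z'\<close>, and only scale invariance of the quotient is at stake.\<close>
  proof (cases "y = 0\<^sub>v n")
    case True
    then have "x = f \<cdot>\<^sub>v z'" using x_eq z'c by (auto intro!: eq_vecI)
    moreover from this have "f \<noteq> 0" using x(2) z'c by auto
    ultimately show ?thesis using rayleigh_smult[OF H_carrier S_carrier z'c] by simp
  next
    case False
    define \<nu> where "\<nu> = Re (sesq S y y)"
    have \<nu>: "\<nu> > 0" using S_pos[OF yc False] by (simp add: \<nu>_def)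
    define w where "w = complex_of_real (1 / sqrt \<nu>) \<cdot>\<^sub>v y"
    have wc: "w \<in> carrier_vec n" using yc by (simp add: w_def)
    have wX: "w \<in> X" unfolding w_def X_def using yX X_def by (intro lin_span_smult[OF G]) simp
    have y_eq: "y = complex_of_real (sqrt \<nu>) \<cdot>\<^sub>v w"
      unfolding w_def using yc \<nu> by (intro eq_vecI) (auto simp flip: of_real_mult)
    have ww: "sesq S w w = 1"
    proof -
      have "sesq S w w = of_real (1 / sqrt \<nu> * (1 / sqrt \<nu>)) * sesq S y y"
        unfolding w_def of_real_mult using yc by (simp add: SS)
      also have "\<dots> = of_real (1 / sqrt \<nu> * (1 / sqrt \<nu>) * \<nu>)"
        using sesq_hermitian_real[OF S_hermitian yc] unfolding \<nu>_def of_real_mult by simp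
      also have "1 / sqrt \<nu> * (1 / sqrt \<nu>) * \<nu> = 1" using \<nu> by simp
      finally show ?thesis by simp
    qed
    have z'w: "sesq S z' w = 0" unfolding w_def using z'y yc z'c by (simp add: SS)
    have wz': "sesq S w z' = 0" using sesq_hermitian[OF S_hermitian z'c wc] z'w by simp
    have uy: "sesq S (u l) y = 0" if "l \<in> {1..<i}" for l
      unfolding y_def using that z p u_carrier[of l] i by (simp add: SS)
    have uw: "sesq S (u l) w = 0" if "l \<in> {1..<i}" for l
      unfolding w_def using that uy[OF that] yc u_carrier[of l] i by (simp add: SS)
    \<comment> \<open>The Galerkin condition turns \<open>S\<close>-orthogonality to
      \<open>z'\<close> into \<open>H\<close>-orthogonality, so \<open>w\<close> and
      \<open>z'\<close> diagonalise both forms.\<close>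
    have Hwz': "sesq H w z' = 0" using gal[OF wX] wz' by simp
    have Hz'w: "sesq H z' w = 0" using sesq_hermitian[OF H wc z'c] Hwz' by simp
    define \<mu> where "\<mu> = Re (sesq H w w)"
    have Hww: "sesq H w w = of_real \<mu>" unfolding \<mu>_def by (rule sesq_hermitian_real[OF H wc])
    have Hz'z': "sesq H z' z' = of_real \<theta>" using gal[OF z'X] z' by simp
    \<comment> \<open>\<open>w\<close> has no coordinates below \<open>i\<close>, so its quotient
      averages eigenvalues that are at least \<open>lam i\<close>.\<close>
    have lam_\<mu>: "lam i \<le> \<mu>"
    proof -
      have "lam i = lam i * (\<Sum>l=1..n. (cmod (sesq S (u l) w))\<^sup>2)"
        using sesq_S_self[OF wc] unfolding ww by (metis mult.right_neutral of_real_eq_1_iff)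
      also have "\<dots> \<le> (\<Sum>l=1..n. lam l * (cmod (sesq S (u l) w))\<^sup>2)"
        unfolding sum_distrib_left
      proof (rule sum_mono)
        fix l assume l: "l \<in> {1..n}"
        show "lam i * (cmod (sesq S (u l) w))\<^sup>2 \<le> lam l * (cmod (sesq S (u l) w))\<^sup>2"
          using uw[of l] lam[OF i l] l by (cases "l < i") (auto intro: mult_right_mono)
      qed
      also have "\<dots> = \<mu>" unfolding \<mu>_def sesq_H_self[OF wc] by (simp only: Re_complex_of_real)
      finally show ?thesis .
    qed
    \<comment> \<open>Zero-based list of the diagonalising basis: positions \<open>0\<close> to
      \<open>i - 2\<close> hold the deflated eigenvectors, \<open>i - 1\<close> holds
      \<open>z'\<close> and \<open>i\<close> holds \<open>w\<close>; \<open>ds\<close> lists the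
      matching diagonal entries of \<open>H\<close>.\<close>
    define v where "v = (\<lambda>j. if j < i - 1 then u (Suc j) else if j = i - 1 then z' else w)"
    define ds where "ds = (\<lambda>j. if j < i - 1 then lam (Suc j) else if j = i - 1 then \<theta> else \<mu>)"
    have ne: "i - 1 \<noteq> i" "i \<noteq> i - 1" "\<not> i < i - 1" using i by auto
    have v_last: "v (i - 1) = z'" "v i = w" "ds (i - 1) = \<theta>" "ds i = \<mu>"
      using ne by (simp_all add: v_def ds_def)
    define Y where "Y = mat_of_cols n (map v [0..<Suc i])"
    have Y: "Y \<in> carrier_mat n (Suc i)" by (rule carrier_matI) (simp_all add: Y_def del: upt_Suc)
    have vX: "v j \<in> X" for j unfolding v_def using uX[of "Suc j"] z'X wX by auto
    have vc: "v j \<in> carrier_vec n" for j using vX[of j] lin_span_carrier[OF G] X_def by simp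
    have col: "col Y j = v j" if "j < Suc i" for j
      unfolding Y_def using that vc[of j] by (subst col_mat_of_cols) (auto simp del: upt_Suc)
    have rng: "\<exists>g \<in> carrier_vec (Suc i). v j = Y *\<^sub>v g" if "j < Suc i" for j
      using mult_unit_vec[OF Y that] col[OF that] by (intro bexI[of _ "unit_vec (Suc i) j"]) auto
    have rz': "\<exists>g \<in> carrier_vec (Suc i). z' = Y *\<^sub>v g" using rng[of "i - 1"] v_last by simp
    have rw: "\<exists>g \<in> carrier_vec (Suc i). w = Y *\<^sub>v g" using rng[of i] v_last by simp
    have ry: "\<exists>g \<in> carrier_vec (Suc i). y = Y *\<^sub>v g"
    proof -
      have "y + 0 \<cdot>\<^sub>v w = y" using yc wc by (intro eq_vecI) auto
      then show ?thesis
        using range_smult_add[OF Y wc wc rw rw, of "sqrt \<nu>" 0] unfolding y_eq[symmetric] by simp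
    qed
    have "\<exists>g \<in> carrier_vec (Suc i). x = Y *\<^sub>v g" if "x \<in> X" for x
    proof (rule lin_span_range[OF Y that[unfolded X_def]])
      fix q assume "q \<in> u ` {1..<i} \<union> {z, p}"
      then consider l where "l \<in> {1..<i}" "q = u l" | "q = z" | "q = p" by auto
      then show "\<exists>g \<in> carrier_vec (Suc i). q = Y *\<^sub>v g"
      proof cases
        case 1
        then have "l - 1 < i - 1" "Suc (l - 1) = l" by auto
        then have "v (l - 1) = q" using 1 by (simp add: v_def)
        then show ?thesis using rng[of "l - 1"] 1 by auto
      next
        case 2
        show ?thesis unfolding 2
          by (subst z_eq) (rule range_smult_add[OF Y yc z'c ry rz'])
      next
        case 3
        show ?thesis unfolding 3
          by (subst p_eq) (rule range_smult_add[OF Y yc z'c ry rz'])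
      qed
    qed
    moreover have "sesq S (v j) (v k) = (if j = k then 1 else 0) \<and>
        sesq H (v j) (v k) = (if j = k then of_real (ds k) else 0)"
      if less: "j < Suc i" "k < Suc i" for j k
    proof -
      have uu: "sesq S (u l) z' = 0" "sesq S z' (u l) = 0" "sesq S (u l) w = 0" "sesq S w (u l) = 0"
        "sesq H (u l) z' = 0" "sesq H z' (u l) = 0" "sesq H (u l) w = 0" "sesq H w (u l) = 0"
        if "l \<in> {1..<i}" for l
      proof -
        have l: "l \<in> {1..n}" using that i by auto
        show 1: "sesq S (u l) z' = 0" by (rule z'(2)[OF that])
        show 2: "sesq S z' (u l) = 0"
          using sesq_hermitian[OF S_hermitian u_carrier[OF l] z'c] 1 by simp
        show 3: "sesq S (u l) w = 0" by (rule uw[OF that])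
        show 4: "sesq S w (u l) = 0"
          using sesq_hermitian[OF S_hermitian u_carrier[OF l] wc] 3 by simp
        show "sesq H (u l) z' = 0" "sesq H (u l) w = 0"
          using sesq_H_u_left[OF l] z'c wc 1 3 by auto
        show "sesq H z' (u l) = 0" "sesq H w (u l) = 0"
          using sesq_H_u_right[OF l] z'c wc 2 4 by auto
      qed
      have jk: "Suc j \<in> {1..n} \<and> Suc j \<in> {1..<i}" if "j < i - 1" for j using that i by auto
      consider "j < i - 1" | "j = i - 1" | "j = i" using less by linarith
      then show ?thesis
      proof cases
        case 1
        have j: "v j = u (Suc j)" "Suc j \<in> {1..<i}" "Suc j \<in> {1..n}" using 1 jk by (auto simp: v_def)
        consider "k < i - 1" | "k = i - 1" | "k = i" using less by linarith
        then show ?thesis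
        proof cases
          case 1
          then have "v k = u (Suc k)" "Suc k \<in> {1..n}" "ds k = lam (Suc k)" using jk[of k] by (auto simp: v_def ds_def)
          then show ?thesis using j u_orthonormal sesq_H_u_left[OF j(3)] u_carrier by auto
        qed (use 1 ne in \<open>simp_all add: j(1) v_last v_last(1,3)[simplified] uu[OF j(2)]\<close>)
      next
        case 2
        have j: "v j = z'" using 2 v_last by simp
        consider "k < i - 1" | "k = i - 1" | "k = i" using less by linarith
        then show ?thesis
        proof cases
          case 1
          then show ?thesis using j 2 jk[of k] uu[of "Suc k"] by (auto simp: v_def)
        qed (use 2 ne in \<open>simp_all add: v_last v_last(1,3)[simplified] z'(1) Hz'z' z'w Hz'w\<close>)
      next
        case 3
        have j: "v j = w" using 3 v_last by simp
        consider "k < i - 1" | "k = i - 1" | "k = i" using less by linarith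
        then show ?thesis
        proof cases
          case 1
          then show ?thesis using j 3 jk[of k] uu[of "Suc k"] by (auto simp: v_def)
        qed (use 3 ne in \<open>simp_all add: v_last v_last(1,3)[simplified] wz' Hwz' ww Hww\<close>)
      qed
    qed
    ultimately have "pair_eigenvalues (mat_adjoint W * H * W) (mat_adjoint W * S * W)
        = sort (map ds [0..<Suc i])"
      by (intro pair_eigenvalues_compression[OF H_carrier S_carrier W Y]) (auto simp: col vX simp del: upt_Suc)
    then have \<theta>nth: "\<theta> = sort (map ds [0..<Suc i]) ! (i - 1)" using \<theta> by simp
    have "\<theta> \<le> \<mu>"
    proof (rule ccontr)
      assume "\<not> \<theta> \<le> \<mu>"
      \<comment> \<open>Under the contrary assumption
        \<open>lam (Suc j) \<le> lam i \<le> \<mu> < \<theta>\<close>, so all \<open>i + 1\<close>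
        entries except the one at \<open>i - 1\<close> lie below \<open>\<theta>\<close>. The entry
        at zero-based position \<open>i - 1\<close> of the sorted list allows at most
        \<open>i - 1\<close> of them.\<close>
      then have less: "ds j < \<theta>" if "j \<in> {..<Suc i} - {i - 1}" for j
      proof (cases "j < i - 1")
        case True
        then have "lam (Suc j) \<le> lam i" using i by (intro lam) auto
        then show ?thesis using True lam_\<mu> \<open>\<not> \<theta> \<le> \<mu>\<close> by (simp add: ds_def)
      next
        case False
        then have "j = i" using that by auto
        then show ?thesis using v_last(4) \<open>\<not> \<theta> \<le> \<mu>\<close> by simp
      qed
      have "length (filter (\<lambda>r. r < \<theta>) (map ds [0..<Suc i])) \<le> i - 1"
        unfolding \<theta>nth by (rule length_filter_less_sort_nth) auto
      moreover have "length (filter (\<lambda>r. r < \<theta>) (map ds [0..<Suc i])) = card {j. j < Suc i \<and> ds j < \<theta>}"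
        unfolding length_filter_conv_card by (rule arg_cong[of _ _ card]) (auto simp del: upt_Suc)
      moreover have "card ({..<Suc i} - {i - 1}) \<le> card {j. j < Suc i \<and> ds j < \<theta>}"
        by (rule card_mono) (use less in auto)
      moreover have "card ({..<Suc i} - {i - 1}) = i" by (subst card_Diff_singleton) auto
      ultimately have "i \<le> i - 1" by linarith
      then show False using i by (cases i) auto
    qed
    \<comment> \<open>In the \<open>S\<close>-orthonormal pair \<open>w, z'\<close> the quotient of
      \<open>x\<close> is the mean of \<open>\<mu>\<close> and \<open>\<theta>\<close> with weights
      \<open>(cmod g)\<^sup>2\<close> and \<open>(cmod f)\<^sup>2\<close>, hence at least
      \<open>\<theta>\<close>.\<close>
    define g where "g = e * complex_of_real (sqrt \<nu>)"
    have x_eq': "x = g \<cdot>\<^sub>v w + f \<cdot>\<^sub>v z'"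
      unfolding x_eq g_def by (subst y_eq) (simp add: smult_smult_assoc)
    have Sx: "sesq S x x = of_real ((cmod g)\<^sup>2 + (cmod f)\<^sup>2)"
      unfolding x_eq' using wc z'c
      by (simp add: SS ww wz' z'w z' complex_norm_square[unfolded of_real_power] mult.commute)
    have Hx: "sesq H x x = of_real ((cmod g)\<^sup>2 * \<mu> + (cmod f)\<^sup>2 * \<theta>)"
      unfolding x_eq' using wc z'c
      by (simp add: HH Hww Hwz' Hz'w Hz'z' complex_norm_square[unfolded of_real_power] mult_ac)
    have xc: "x \<in> carrier_vec n" unfolding x_eq' using wc z'c by simp
    have pos: "(cmod g)\<^sup>2 + (cmod f)\<^sup>2 > 0" using S_pos[OF xc x(2)] unfolding Sx by (simp only: Re_complex_of_real)
    have "rayleigh H S x = ((cmod g)\<^sup>2 * \<mu> + (cmod f)\<^sup>2 * \<theta>) / ((cmod g)\<^sup>2 + (cmod f)\<^sup>2)"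
      unfolding rayleigh_def Sx Hx of_real_divide[symmetric] by (simp only: Re_complex_of_real)
    moreover have "\<theta> * ((cmod g)\<^sup>2 + (cmod f)\<^sup>2) \<le> (cmod g)\<^sup>2 * \<mu> + (cmod f)\<^sup>2 * \<theta>"
      using mult_left_mono[OF \<open>\<theta> \<le> \<mu>\<close>, of "(cmod g)\<^sup>2"] by (simp add: algebra_simps)
    ultimately show ?thesis unfolding \<theta>eq using pos by (simp add: pos_le_divide_eq)
  qed
qed

end

subsection \<open>Convergence\<close>

theorem theorem3p3:
  fixes n i :: nat
    and H S K :: "complex mat"
    and lam :: "nat \<Rightarrow> real"
    and u :: "nat \<Rightarrow> complex vec"
    and z z' :: "complex vec"
    and \<sigma> \<kappa> :: real
  assumes H: "hermitian_mat n H"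
    and S: "pos_def_mat n S"
    and lam: "pair_eigenvalues H S = map lam [1..<Suc n]"
    and u: "S_orthonormal_basis n S u"
    and Hu: "\<And>l. l \<in> {1..n} \<Longrightarrow> H *\<^sub>v u l = complex_of_real (lam l) \<cdot>\<^sub>v (S *\<^sub>v u l)"
    and i: "1 \<le> i" "i < n"
    and z: "z \<in> lin_span n (u ` {i..n})" "z \<noteq> 0\<^sub>v n"
    and \<sigma>: "lam i < \<sigma>" "\<sigma> < (lam i + lam (Suc i)) / 2"
    and K: "K \<in> carrier_mat n n"
      "inverts_mat (H - complex_of_real \<sigma> \<cdot>\<^sub>m S) K"
      "inverts_mat K (H - complex_of_real \<sigma> \<cdot>\<^sub>m S)"
    and step: "psd_id_step n H S i u K z z'"
    and \<rho>_\<sigma>: "rayleigh H S z \<noteq> \<sigma>"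
    and \<rho>: "lam i < rayleigh H S z" "rayleigh H S z < lam (Suc i)"
    and \<kappa>: "\<kappa> = ((lam i - \<sigma>) / (lam (Suc i) - \<sigma>)) * ((lam n - lam (Suc i)) / (lam n - lam i))"
  shows "(rayleigh H S z' - lam i) / (lam (Suc i) - rayleigh H S z')
       \<le> (\<kappa> / (2 - \<kappa>))\<^sup>2 * ((rayleigh H S z - lam i) / (lam (Suc i) - rayleigh H S z))"
proof -
  interpret eigenframe n H S lam u by unfold_locales (use H S u Hu in auto)
  have "sorted (map lam [1..<Suc n])"
    unfolding lam[symmetric] pair_eigenvalues_def by simp
  then have lam_mono: "lam l \<le> lam m" if "l \<in> {1..n}" "m \<in> {1..n}" "l \<le> m" for l m
    using sorted_nth_mono[of "map lam [1..<Suc n]" "l - 1" "m - 1"] that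
    by (auto simp del: upt_Suc)
  have \<sigma>1: "\<sigma> < lam (Suc i)" using \<sigma> by (simp add: field_simps)
  define \<rho> where "\<rho> = rayleigh H S z"
  define p where "p = K *\<^sub>v residual H S z"
  have G: "u ` {i..n} \<subseteq> carrier_vec n" using u_carrier i by auto
  have zc: "z \<in> carrier_vec n" by (rule lin_span_carrier[OF G z(1)])
  have pc: "p \<in> carrier_vec n"
    using K zc H_carrier S_carrier unfolding p_def residual_def by auto
  have z0: "sesq S (u l) z = 0" if l: "l \<in> {1..<i}" for l
    using z(1) G
  proof (rule lin_span_induct)
    note ul = u_carrier[of l]
    show "sesq S (u l) (0\<^sub>v n) = 0" using ul l i by (simp add: sesq_zero_right[OF S_carrier])
    show "sesq S (u l) x = 0" if "x \<in> u ` {i..n}" for x using that l i u_orthonormal[of l] by auto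
    show "sesq S (u l) (x + y) = 0" if "x \<in> carrier_vec n" "y \<in> carrier_vec n"
      "sesq S (u l) x = 0" "sesq S (u l) y = 0" for x y
      using that ul l i by (simp add: sesq_add_right[OF S_carrier])
    show "sesq S (u l) (c \<cdot>\<^sub>v x) = 0" if "x \<in> carrier_vec n" "sesq S (u l) x = 0" for c x
      using that ul l i by (simp add: sesq_smult_right[OF S_carrier])
  qed
  have lam_\<sigma>: "lam l \<noteq> \<sigma>" if "l \<in> {1..n}" for l
    using lam_mono[of l i] lam_mono[of "Suc i" l] that i \<sigma> \<sigma>1 by (cases "l \<le> i") auto
  have p_coord: "sesq S (u l) p = (lam l - \<rho>) / (lam l - \<sigma>) * sesq S (u l) z" if "l \<in> {1..n}" for l
    using preconditioned_coordinates[OF that zc K(1,2)] lam_\<sigma>[OF that]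
    unfolding p_def[symmetric] \<rho>_def[symmetric] by (simp add: field_simps flip: of_real_diff)
  have p0: "sesq S (u l) p = 0" if "l \<in> {1..<i}" for l
    using p_coord[of l] z0[OF that] that i by simp

  define m where "m = (1 / (lam (Suc i) - \<sigma>) + 1 / (lam n - \<sigma>)) / 2"
  define f where "f = (\<lambda>l. m - 1 / (lam l - \<sigma>))"
  have n1: "lam (Suc i) \<le> lam n" using lam_mono i by simp
  note filt = shift_invert_filter[OF \<sigma>(1) \<sigma>1 n1 m_def \<kappa>]
  \<comment> \<open>As \<open>b * (\<sigma> - \<rho>) = -1\<close>, the vector \<open>b p\<close>
    has filter \<open>b - 1 / (t - \<sigma>)\<close>; adding \<open>(m - b) z\<close> replaces the
    constant by the midpoint \<open>m\<close>.\<close>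
  define b where "b = 1 / (\<rho> - \<sigma>)"
  define a where "a = m - b"
  define x where "x = complex_of_real a \<cdot>\<^sub>v z + complex_of_real b \<cdot>\<^sub>v p"
  have xc: "x \<in> carrier_vec n" using zc pc by (simp add: x_def)
  have x_coord: "sesq S (u l) x = f l * sesq S (u l) z" if l: "l \<in> {1..n}" for l
  proof -
    have "sesq S (u l) x = complex_of_real (a + b * ((lam l - \<rho>) / (lam l - \<sigma>))) * sesq S (u l) z"
      using u_carrier[OF l] zc pc p_coord[OF l] unfolding x_def
      by (simp add: sesq_add_right[OF S_carrier] sesq_smult_right[OF S_carrier] algebra_simps)
    also have "a + b * ((lam l - \<rho>) / (lam l - \<sigma>)) = f l"
      using lam_\<sigma>[OF l] \<rho>_\<sigma> unfolding a_def b_def f_def \<rho>_def[symmetric]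
      by (simp add: divide_simps) (simp add: algebra_simps)
    finally show ?thesis .
  qed
  define w where "w = (\<lambda>l. (cmod (sesq S (u l) z))\<^sup>2)"
  have split: "(\<Sum>l=1..n. g l) = (\<Sum>l=i..n. g l)" if "\<And>l. l \<in> {1..<i} \<Longrightarrow> g l = 0" for g :: "nat \<Rightarrow> real"
    by (rule sum.mono_neutral_right) (use that i in auto)
  have \<rho>_eq: "\<rho> = (\<Sum>l=i..n. lam l * w l) / (\<Sum>l=i..n. w l)"
    unfolding \<rho>_def rayleigh_eq[OF zc] w_def by (subst (1 2) split) (auto simp: z0)
  have wx: "(cmod (sesq S (u l) x))\<^sup>2 = w l * (f l)\<^sup>2" if "l \<in> {1..n}" for l
    unfolding x_coord[OF that] w_def by (simp add: norm_mult power_mult_distrib mult.commute)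
  have S_eq: "(\<Sum>l=1..n. (cmod (sesq S (u l) x))\<^sup>2) = (\<Sum>l=i..n. w l * (f l)\<^sup>2)"
    by (subst split) (use i in \<open>auto simp: wx w_def z0\<close>)
  have H_eq: "(\<Sum>l=1..n. lam l * (cmod (sesq S (u l) x))\<^sup>2) = (\<Sum>l=i..n. lam l * (w l * (f l)\<^sup>2))"
    by (subst split) (use i in \<open>auto simp: wx w_def z0\<close>)
  have R: "rayleigh H S x = (\<Sum>l=i..n. lam l * (w l * (f l)\<^sup>2)) / (\<Sum>l=i..n. w l * (f l)\<^sup>2)"
    unfolding rayleigh_eq[OF xc] S_eq H_eq ..
  have wpos: "0 < (\<Sum>l=i..n. w l)"
  proof -
    have "(\<Sum>l=1..n. w l) > 0"
      using S_pos[OF zc z(2)] unfolding sesq_S_self[OF zc] w_def by (simp only: Re_complex_of_real)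
    then show ?thesis by (subst (asm) split) (auto simp: w_def z0)
  qed
  have f0: "f i \<noteq> 0" using filt(1) by (simp add: f_def)
  have fk: "\<bar>f k\<bar> \<le> \<bar>\<kappa> / (2 - \<kappa>)\<bar> * \<bar>f i\<bar>" if "k \<in> {Suc i..n}" for k
    unfolding f_def using that i by (intro filt(3) lam_mono) auto
  have \<rho>1: "\<rho> < lam (Suc i)" using \<open>rayleigh H S z < lam (Suc i)\<close> by (simp add: \<rho>_def)
  \<comment> \<open>\<open>\<kappa>\<close> is nonpositive here, so the damping factor is taken in
    absolute value; squaring removes it at the end.\<close>
  have contraction: "0 < (\<Sum>l=i..n. w l * (f l)\<^sup>2)" "rayleigh H S x < lam (Suc i)"
    "(rayleigh H S x - lam i) / (lam (Suc i) - rayleigh H S x)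
      \<le> \<bar>\<kappa> / (2 - \<kappa>)\<bar>\<^sup>2 * ((\<rho> - lam i) / (lam (Suc i) - \<rho>))"
    by (rule weighted_mean_contraction[where l = lam and a = w and f = f and \<epsilon> = "\<bar>\<kappa> / (2 - \<kappa>)\<bar>",
          OF i(2) _ _ _ wpos f0 fk _ filt(2) \<rho>_eq \<rho>1 R];
        use i lam_mono \<sigma>(1) \<sigma>1 in \<open>auto simp: w_def\<close>)+
  have x0: "x \<noteq> 0\<^sub>v n"
  proof
    assume "x = 0\<^sub>v n"
    then have "sesq S x x = 0" using xc by (simp add: sesq_zero_right[OF S_carrier])
    then show False using contraction(1) unfolding sesq_S_self[OF xc] S_eq of_real_eq_0_iff by simp
  qed
  have "rayleigh H S z' \<le> rayleigh H S x"
  proof (rule deflated_ritz_vector_minimal[of i z p z' x])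
    show "ritz_vector n H S (lin_span n (u ` {1..<i} \<union> {z, p})) i z'" "sesq S z' z' = 1"
      "\<And>l. l \<in> {1..<i} \<Longrightarrow> sesq S (u l) z' = 0"
      using step unfolding psd_id_step_def Let_def p_def by blast+
  qed (use i lam_mono zc pc z0 p0 x0 in \<open>auto simp: x_def\<close>)
  then have "(rayleigh H S z' - lam i) / (lam (Suc i) - rayleigh H S z')
      \<le> (rayleigh H S x - lam i) / (lam (Suc i) - rayleigh H S x)"
  proof -
    \<comment> \<open>Minimality transfers to the claimed ratio because
      \<open>(s - p) / (q - s) = (q - p) / (q - s) - 1\<close> increases with \<open>s\<close> below
      \<open>q\<close>.\<close>
    have mono: "(s - p) / (q - s) \<le> (t - p) / (q - t)" if "s \<le> t" "t < q" "p < q" for s t p q :: real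
    proof -
      have "(q - p) / (q - s) \<le> (q - p) / (q - t)"
        using that by (intro divide_left_mono) auto
      moreover have "(s - p) / (q - s) = (q - p) / (q - s) - 1" "(t - p) / (q - t) = (q - p) / (q - t) - 1"
        using that by (auto simp: field_simps)
      ultimately show ?thesis by simp
    qed
    show ?thesis using \<open>rayleigh H S z' \<le> rayleigh H S x\<close> contraction(2) \<sigma>(1) \<sigma>1
      by (intro mono) auto
  qed
  also note contraction(3)
  finally show ?thesis unfolding \<rho>_def power2_abs .
qed

end
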